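(* Let $k$ be a field of characteristic $7$ and let $R$ be the localization at the ideal $(x_1,\ldots,x_5)$ of the ring $$\frac{k[x_1,\ldots,x_5]}{(x_1^4+x_2^4+x_3^4+x_4^4+x_5^4)}.$$ Then the test ideal $\tau$ of $R$ is $(x_1,\ldots,x_5)$, the maximal ideal of $R$.
   Context: Let $R$ be a commutative Noetherian ring of prime characteristic $p>0$; the letter $q$ always denotes a power $p^e$, $e\in\mathbb{N}$. For an ideal $I\subseteq R$, $I^{[q]}$ is the ideal generated by the $q$th powers of all elements of $I$. An element $u\in R$ is in the tight closure $I^*$ of $I$ if there exists $c\in R$, not in any minimal prime of $R$, such that $cu^q\in I^{[q]}$ for all large $q=p^e$. The test ideal $\tau$ of $R$ is the ideal of all $c\in R$ such that for every ideal $I\subseteq R$ and every $u\in I^*$ one has $cu^q\in I^{[q]}$ for all $q=p^e$. *)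

theory Defs
  imports
    "HOL-Algebra.QuotRing"
    "HOL-Algebra.Algebraic_Closure_Type"
    "HOL-Library.Poly_Mapping"
    "HOL-Library.Numeral_Type"
begin

section \<open>Tight closure and the test ideal\<close>

text \<open>The same convention as for \<open>CHAR('a)\<close> on types: the value is the least positive such
  \<open>n\<close>, and 0 if there is none.\<close>
definition ring_char :: "('a, 'b) ring_scheme \<Rightarrow> nat" where
  "ring_char R = Gcd {n. [n] \<cdot>\<^bsub>R\<^esub> \<one>\<^bsub>R\<^esub> = \<zero>\<^bsub>R\<^esub>}"

definition bracket_power :: "('a, 'b) ring_scheme \<Rightarrow> 'a set \<Rightarrow> nat \<Rightarrow> 'a set" where
  "bracket_power R I q = Idl\<^bsub>R\<^esub> ((\<lambda>a. a [^]\<^bsub>R\<^esub> q) ` I)"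

definition minimal_primes :: "('a, 'b) ring_scheme \<Rightarrow> 'a set set" where
  "minimal_primes R =
     {P. primeideal P R \<and> (\<forall>Q. primeideal Q R \<longrightarrow> Q \<subseteq> P \<longrightarrow> Q = P)}"

text \<open>The following two notions are meant for a Noetherian commutative ring of prime
  characteristic \<open>ring_char R\<close>.\<close>

definition tight_closure :: "('a, 'b) ring_scheme \<Rightarrow> 'a set \<Rightarrow> 'a set" where
  "tight_closure R I =
     {u \<in> carrier R. \<exists>c \<in> carrier R - \<Union> (minimal_primes R). \<exists>e0. \<forall>e\<ge>e0.
        c \<otimes>\<^bsub>R\<^esub> u [^]\<^bsub>R\<^esub> (ring_char R ^ e) \<in> bracket_power R I (ring_char R ^ e)}"

definition test_ideal :: "('a, 'b) ring_scheme \<Rightarrow> 'a set" where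
  "test_ideal R =
     {c \<in> carrier R. \<forall>I. ideal I R \<longrightarrow> (\<forall>u \<in> tight_closure R I. \<forall>e.
        c \<otimes>\<^bsub>R\<^esub> u [^]\<^bsub>R\<^esub> (ring_char R ^ e) \<in> bracket_power R I (ring_char R ^ e))}"


section \<open>Localization of a commutative ring\<close>

definition fraction_rel :: "('a, 'b) ring_scheme \<Rightarrow> 'a set \<Rightarrow> (('a \<times> 'a) \<times> ('a \<times> 'a)) set" where
  "fraction_rel R S = {((a, s), (b, t)). a \<in> carrier R \<and> s \<in> S \<and> b \<in> carrier R \<and> t \<in> S \<and>
     (\<exists>w\<in>S. w \<otimes>\<^bsub>R\<^esub> (t \<otimes>\<^bsub>R\<^esub> a) = w \<otimes>\<^bsub>R\<^esub> (s \<otimes>\<^bsub>R\<^esub> b))}"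

definition fraction :: "('a, 'b) ring_scheme \<Rightarrow> 'a set \<Rightarrow> 'a \<Rightarrow> 'a \<Rightarrow> ('a \<times> 'a) set" where
  "fraction R S a s = fraction_rel R S `` {(a, s)}"

definition localization :: "('a, 'b) ring_scheme \<Rightarrow> 'a set \<Rightarrow> ('a \<times> 'a) set ring" where
  "localization R S =
    \<lparr> carrier = (carrier R \<times> S) // fraction_rel R S,
      monoid.mult = (\<lambda>U V. \<Union>(a, s)\<in>U. \<Union>(b, t)\<in>V. fraction R S (a \<otimes>\<^bsub>R\<^esub> b) (s \<otimes>\<^bsub>R\<^esub> t)),
      monoid.one = fraction R S \<one>\<^bsub>R\<^esub> \<one>\<^bsub>R\<^esub>,
      ring.zero = fraction R S \<zero>\<^bsub>R\<^esub> \<one>\<^bsub>R\<^esub>,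
      ring.add = (\<lambda>U V. \<Union>(a, s)\<in>U. \<Union>(b, t)\<in>V.
               fraction R S ((t \<otimes>\<^bsub>R\<^esub> a) \<oplus>\<^bsub>R\<^esub> (s \<otimes>\<^bsub>R\<^esub> b)) (s \<otimes>\<^bsub>R\<^esub> t)) \<rparr>"

definition localization_at :: "('a, 'b) ring_scheme \<Rightarrow> 'a set \<Rightarrow> ('a \<times> 'a) set ring" where
  "localization_at R P = localization R (carrier R - P)"

locale mult_subset = cring R for R (structure) +
  fixes S
  assumes S_carrier: "S \<subseteq> carrier R"
    and one_S: "\<one> \<in> S"
    and mult_S: "\<lbrakk>s \<in> S; t \<in> S\<rbrakk> \<Longrightarrow> s \<otimes> t \<in> S"
begin

lemma S_closed [simp, intro]: "s \<in> S \<Longrightarrow> s \<in> carrier R"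
  using S_carrier by blast

lemma fraction_rel_iff:
  "((a, s), (b, t)) \<in> fraction_rel R S \<longleftrightarrow>
     a \<in> carrier R \<and> s \<in> S \<and> b \<in> carrier R \<and> t \<in> S \<and> (\<exists>w\<in>S. w \<otimes> (t \<otimes> a) = w \<otimes> (s \<otimes> b))"
  by (simp add: fraction_rel_def)

lemma equiv_fraction_rel: "equiv (carrier R \<times> S) (fraction_rel R S)"
proof (rule equivI)
  show "fraction_rel R S \<subseteq> (carrier R \<times> S) \<times> (carrier R \<times> S)"
    by (auto simp: fraction_rel_def)
  show "refl_on (carrier R \<times> S) (fraction_rel R S)"
    using one_S by (auto simp: refl_on_def fraction_rel_def)
  show "sym (fraction_rel R S)"
    by (auto simp: sym_def fraction_rel_def) metis
  show "trans (fraction_rel R S)"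
  proof (rule transI, clarsimp simp: fraction_rel_iff)
    fix a s b t c u v w
    assume *: "a \<in> carrier R" "s \<in> S" "b \<in> carrier R" "t \<in> S" "c \<in> carrier R" "u \<in> S"
      "v \<in> S" "w \<in> S" "v \<otimes> (t \<otimes> a) = v \<otimes> (s \<otimes> b)" "w \<otimes> (u \<otimes> b) = w \<otimes> (t \<otimes> c)"
    have "(w \<otimes> (v \<otimes> t)) \<otimes> (u \<otimes> a) = (w \<otimes> u) \<otimes> (v \<otimes> (t \<otimes> a))"
      using *(1-8) by (simp add: m_ac)
    also have "\<dots> = (w \<otimes> u) \<otimes> (v \<otimes> (s \<otimes> b))"
      using * by simp
    also have "\<dots> = (v \<otimes> s) \<otimes> (w \<otimes> (u \<otimes> b))"
      using *(1-8) by (simp add: m_ac)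
    also have "\<dots> = (v \<otimes> s) \<otimes> (w \<otimes> (t \<otimes> c))"
      using * by simp
    also have "\<dots> = (w \<otimes> (v \<otimes> t)) \<otimes> (s \<otimes> c)"
      using *(1-8) by (simp add: m_ac)
    finally show "\<exists>w\<in>S. w \<otimes> (u \<otimes> a) = w \<otimes> (s \<otimes> c)"
      using * mult_S by blast
  qed
qed

lemma fraction_eq_iff:
  assumes "a \<in> carrier R" "s \<in> S" "b \<in> carrier R" "t \<in> S"
  shows "fraction R S a s = fraction R S b t \<longleftrightarrow> (\<exists>w\<in>S. w \<otimes> (t \<otimes> a) = w \<otimes> (s \<otimes> b))"
  unfolding fraction_def using assms
  by (subst eq_equiv_class_iff[OF equiv_fraction_rel]) (auto simp: fraction_rel_iff)

lemma fraction_eqI: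
  assumes "a \<in> carrier R" "s \<in> S" "b \<in> carrier R" "t \<in> S" "t \<otimes> a = s \<otimes> b"
  shows "fraction R S a s = fraction R S b t"
  using assms one_S by (subst fraction_eq_iff) auto

lemma fraction_closed [simp, intro]:
  "\<lbrakk>a \<in> carrier R; s \<in> S\<rbrakk> \<Longrightarrow> fraction R S a s \<in> carrier (localization R S)"
  by (auto simp: localization_def fraction_def intro!: quotientI)

lemma fraction_cases:
  assumes "U \<in> carrier (localization R S)"
  obtains a s where "a \<in> carrier R" "s \<in> S" "U = fraction R S a s"
  using assms by (auto simp: localization_def fraction_def elim!: quotientE)

lemma localization_one: "\<one>\<^bsub>localization R S\<^esub> = fraction R S \<one> \<one>"
  and localization_zero: "\<zero>\<^bsub>localization R S\<^esub> = fraction R S \<zero> \<one>"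
  by (simp_all add: localization_def)

lemma UN_fraction_eq:
  assumes "a \<in> carrier R" "s \<in> S" "b \<in> carrier R" "t \<in> S"
    and "\<And>a' s' b' t'. \<lbrakk>((a, s), (a', s')) \<in> fraction_rel R S; ((b, t), (b', t')) \<in> fraction_rel R S\<rbrakk>
           \<Longrightarrow> F a' s' b' t' = W"
  shows "(\<Union>(a, s)\<in>fraction R S a s. \<Union>(b, t)\<in>fraction R S b t. F a s b t) = W"
proof -
  have "(a, s) \<in> fraction R S a s" "(b, t) \<in> fraction R S b t"
    using equiv_class_self[OF equiv_fraction_rel] assms(1-4) by (auto simp: fraction_def)
  then show ?thesis
    using assms(5) by (fastforce simp: fraction_def)
qed

lemma mult_fraction [simp]:
  assumes "a \<in> carrier R" "s \<in> S" "b \<in> carrier R" "t \<in> S"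
  shows "fraction R S a s \<otimes>\<^bsub>localization R S\<^esub> fraction R S b t = fraction R S (a \<otimes> b) (s \<otimes> t)"
proof -
  have "(\<Union>(a, s)\<in>fraction R S a s. \<Union>(b, t)\<in>fraction R S b t. fraction R S (a \<otimes> b) (s \<otimes> t)) =
     fraction R S (a \<otimes> b) (s \<otimes> t)"
  proof (rule UN_fraction_eq[OF assms])
    fix a' s' b' t'
    assume "((a, s), (a', s')) \<in> fraction_rel R S" "((b, t), (b', t')) \<in> fraction_rel R S"
    then obtain v w where *: "a' \<in> carrier R" "s' \<in> S" "b' \<in> carrier R" "t' \<in> S" "v \<in> S" "w \<in> S"
      and v: "v \<otimes> (s' \<otimes> a) = v \<otimes> (s \<otimes> a')" and w: "w \<otimes> (t' \<otimes> b) = w \<otimes> (t \<otimes> b')"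
      by (auto simp: fraction_rel_iff)
    have "(v \<otimes> w) \<otimes> ((s \<otimes> t) \<otimes> (a' \<otimes> b')) = (v \<otimes> (s \<otimes> a')) \<otimes> (w \<otimes> (t \<otimes> b'))"
      using * assms by (simp add: m_ac)
    also have "\<dots> = (v \<otimes> (s' \<otimes> a)) \<otimes> (w \<otimes> (t' \<otimes> b))"
      by (simp add: v w)
    also have "\<dots> = (v \<otimes> w) \<otimes> ((s' \<otimes> t') \<otimes> (a \<otimes> b))"
      using * assms by (simp add: m_ac)
    finally show "fraction R S (a' \<otimes> b') (s' \<otimes> t') = fraction R S (a \<otimes> b) (s \<otimes> t)"
      using * assms mult_S by (subst fraction_eq_iff) auto
  qed
  then show ?thesis
    by (simp add: localization_def)
qed

lemma add_fraction [simp]: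
  assumes "a \<in> carrier R" "s \<in> S" "b \<in> carrier R" "t \<in> S"
  shows "fraction R S a s \<oplus>\<^bsub>localization R S\<^esub> fraction R S b t
           = fraction R S ((t \<otimes> a) \<oplus> (s \<otimes> b)) (s \<otimes> t)"
proof -
  have "(\<Union>(a, s)\<in>fraction R S a s. \<Union>(b, t)\<in>fraction R S b t. fraction R S ((t \<otimes> a) \<oplus> (s \<otimes> b)) (s \<otimes> t)) =
     fraction R S ((t \<otimes> a) \<oplus> (s \<otimes> b)) (s \<otimes> t)"
  proof (rule UN_fraction_eq[OF assms])
    fix a' s' b' t'
    assume "((a, s), (a', s')) \<in> fraction_rel R S" "((b, t), (b', t')) \<in> fraction_rel R S"
    then obtain v w where *: "a' \<in> carrier R" "s' \<in> S" "b' \<in> carrier R" "t' \<in> S" "v \<in> S" "w \<in> S"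
      and v: "v \<otimes> (s' \<otimes> a) = v \<otimes> (s \<otimes> a')" and w: "w \<otimes> (t' \<otimes> b) = w \<otimes> (t \<otimes> b')"
      by (auto simp: fraction_rel_iff)
    have "(v \<otimes> w) \<otimes> ((s \<otimes> t) \<otimes> ((t' \<otimes> a') \<oplus> (s' \<otimes> b'))) =
        (w \<otimes> (t \<otimes> t')) \<otimes> (v \<otimes> (s \<otimes> a')) \<oplus> (v \<otimes> (s \<otimes> s')) \<otimes> (w \<otimes> (t \<otimes> b'))"
      using * assms by (simp add: m_ac r_distr)
    also have "\<dots> = (w \<otimes> (t \<otimes> t')) \<otimes> (v \<otimes> (s' \<otimes> a)) \<oplus> (v \<otimes> (s \<otimes> s')) \<otimes> (w \<otimes> (t' \<otimes> b))"
      by (simp add: v w)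
    also have "\<dots> = (v \<otimes> w) \<otimes> ((s' \<otimes> t') \<otimes> ((t \<otimes> a) \<oplus> (s \<otimes> b)))"
      using * assms by (simp add: m_ac r_distr)
    finally show "fraction R S ((t' \<otimes> a') \<oplus> (s' \<otimes> b')) (s' \<otimes> t')
        = fraction R S ((t \<otimes> a) \<oplus> (s \<otimes> b)) (s \<otimes> t)"
      using * assms mult_S by (subst fraction_eq_iff) auto
  qed
  then show ?thesis
    by (simp add: localization_def)
qed

lemma cring_localization: "cring (localization R S)"
proof (rule cringI)
  let ?L = "localization R S"
  show "abelian_group ?L"
  proof (rule abelian_groupI)
    fix U assume "U \<in> carrier ?L"
    then obtain a s where U: "a \<in> carrier R" "s \<in> S" "U = fraction R S a s"
      by (rule fraction_cases)
    have "fraction R S (\<ominus> a) s \<oplus>\<^bsub>?L\<^esub> U = fraction R S \<zero> (s \<otimes> s)"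
      using U by (simp add: r_minus l_neg)
    also have "\<dots> = \<zero>\<^bsub>?L\<^esub>"
      unfolding localization_zero using U by (intro fraction_eqI) (simp_all add: one_S mult_S)
    finally have "fraction R S (\<ominus> a) s \<oplus>\<^bsub>?L\<^esub> U = \<zero>\<^bsub>?L\<^esub>" .
    then show "\<exists>V\<in>carrier ?L. V \<oplus>\<^bsub>?L\<^esub> U = \<zero>\<^bsub>?L\<^esub>"
      using U by blast
  qed (auto simp: localization_zero one_S mult_S m_ac a_ac r_distr elim!: fraction_cases
         intro!: fraction_eqI)
  show "comm_monoid ?L"
    by (rule comm_monoidI)
      (auto simp: localization_one one_S mult_S m_ac elim!: fraction_cases intro!: fraction_eqI)
  show "(U \<oplus>\<^bsub>?L\<^esub> V) \<otimes>\<^bsub>?L\<^esub> W = U \<otimes>\<^bsub>?L\<^esub> W \<oplus>\<^bsub>?L\<^esub> V \<otimes>\<^bsub>?L\<^esub> W"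
    if UVW: "U \<in> carrier ?L" "V \<in> carrier ?L" "W \<in> carrier ?L" for U V W
  proof -
    obtain a s b t c u where *: "a \<in> carrier R" "s \<in> S" "b \<in> carrier R" "t \<in> S" "c \<in> carrier R" "u \<in> S"
      and eqs: "U = fraction R S a s" "V = fraction R S b t" "W = fraction R S c u"
      using UVW by (metis fraction_cases)
    show ?thesis
      unfolding eqs using *
      by (simp add: mult_S) (rule fraction_eqI, simp_all add: mult_S m_ac r_distr l_distr)
  qed
qed

end


section \<open>The local ring of the quartic hypersurface at the origin\<close>

text \<open>Polynomials in five variables: the variables are indexed by the five-element type \<open>5\<close>,
  exponent vectors are finitely supported functions \<open>5 \<Rightarrow>\<^sub>0 nat\<close>, and a polynomial is a
  finitely supported function from exponent vectors to the coefficient field (multiplication on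
  \<open>\<Rightarrow>\<^sub>0\<close> is convolution).\<close>

type_synonym 'k poly5 = "(5 \<Rightarrow>\<^sub>0 nat) \<Rightarrow>\<^sub>0 'k"

definition poly5_ring :: "'k::field itself \<Rightarrow> 'k poly5 ring" where
  "poly5_ring _ = ring_of_type_algebra"

definition poly_var :: "5 \<Rightarrow> 'k::field poly5" where
  "poly_var i = Poly_Mapping.single (Poly_Mapping.single i 1) 1"

definition quartic_ideal :: "'k::field itself \<Rightarrow> 'k poly5 set" where
  "quartic_ideal k = Idl\<^bsub>poly5_ring k\<^esub> {\<Sum>i\<in>UNIV. poly_var i ^ 4}"

definition quartic_ring :: "'k::field itself \<Rightarrow> 'k poly5 set ring" where
  "quartic_ring k = poly5_ring k Quot quartic_ideal k"

definition quartic_var :: "'k::field itself \<Rightarrow> 5 \<Rightarrow> 'k poly5 set" where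
  "quartic_var k i = quartic_ideal k +>\<^bsub>poly5_ring k\<^esub> poly_var i"

definition origin_ideal :: "'k::field itself \<Rightarrow> 'k poly5 set set" where
  "origin_ideal k = Idl\<^bsub>quartic_ring k\<^esub> (range (quartic_var k))"

definition quartic_local_ring :: "'k::field itself \<Rightarrow> ('k poly5 set \<times> 'k poly5 set) set ring" where
  "quartic_local_ring k = localization_at (quartic_ring k) (origin_ideal k)"

definition local_var :: "'k::field itself \<Rightarrow> 5 \<Rightarrow> ('k poly5 set \<times> 'k poly5 set) set" where
  "local_var k i = fraction (quartic_ring k) (carrier (quartic_ring k) - origin_ideal k)
                     (quartic_var k i) \<one>\<^bsub>quartic_ring k\<^esub>"

end

theory Submission
  imports Defs
begin

text \<open>Write \<open>f = x\<^sub>i\<^sup>4 + g\<close>.  Every \<open>c\<close> outside \<open>(f)\<close> has a multiple, its norm, which modulo \<open>f\<close> is a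
  nonzero polynomial \<open>a\<close> free of \<open>x\<^sub>i\<close>.  If \<open>\<Psi>\<close> is additive with \<open>\<Psi>(s\<^sup>Q h) = s \<Psi>(h)\<close> and preserves
  \<open>(f)\<close>, then \<open>c u\<^bsup>qQ\<^esup> \<in> I\<^bsup>[qQ]\<^esup>\<close> implies \<open>\<Psi>(c) u\<^sup>q \<in> I\<^bsup>[q]\<^esup>\<close>.  Such operators are obtained by
  multiplying with \<open>f\<^bsup>Q-1\<^esup>\<close> and extracting the monomials in one residue class of exponents modulo \<open>Q\<close>.
  For large \<open>Q\<close> one of them maps \<open>x\<^sub>i\<^sup>3 a\<close> to \<open>x\<^sub>i\<^sup>3\<close>; for \<open>Q = 7\<close> the class of \<open>(4,4,4,4,4)\<close>
  maps \<open>x\<^sub>i\<^sup>3\<close> to a nonzero multiple of \<open>x\<^sub>i\<close>, the coefficient being the multinomial \<open>6!/2! = 360\<close>.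
  Hence all \<open>x\<^sub>i\<close> lie in the test ideal.

  Conversely, \<open>x\<^sub>i\<^bsup>21\<^esup> = - x\<^sub>i g\<^sup>5\<close> modulo \<open>f\<close>, and every monomial of \<open>g\<^sup>5\<close> is divisible by some
  \<open>x\<^sub>j\<^sup>8\<close>, so \<open>x\<^sub>i\<^sup>3\<close> is in the tight closure of the ideal of the other four variables, but not
  in that ideal.  Hence 1 is not in the test ideal.\<close>

section \<open>Polynomial mappings\<close>

lemma sum_single_keys:
  "(\<Sum>m\<in>Poly_Mapping.keys h. Poly_Mapping.single m (Poly_Mapping.lookup h m)) = h"
  by (rule poly_mapping_eqI)
    (simp add: lookup_sum lookup_single when_def in_keys_iff sum.If_cases)

text \<open>Additive claims about polynomials reduce to single terms; multiplicative ones use it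
  twice, once for each factor. The polynomial 0 is covered as a term with coefficient 0.\<close>

lemma poly_mapping_induct_single [case_names single add]:
  fixes h :: "'a \<Rightarrow>\<^sub>0 'b::comm_monoid_add"
  assumes single: "\<And>m a. Q (Poly_Mapping.single m a)"
    and add: "\<And>h h'. Q h \<Longrightarrow> Q h' \<Longrightarrow> Q (h + h')"
  shows "Q h"
proof -
  have "Q (\<Sum>m\<in>A. Poly_Mapping.single m (Poly_Mapping.lookup h m))" if "finite A" for A
    using that
  proof (induction A rule: finite_induct)
    case empty
    show ?case using single[of undefined 0] by simp
  next
    case (insert m A)
    then show ?case using single add by simp
  qed
  then show ?thesis
    by (metis finite_keys sum_single_keys)
qed

lemma CHAR_poly_mapping: "CHAR('a::comm_monoid_add \<Rightarrow>\<^sub>0 'b::semiring_1) = CHAR('b)"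
proof (rule CHAR_eqI)
  show "of_nat CHAR('b) = (0 :: 'a \<Rightarrow>\<^sub>0 'b)"
    by (simp flip: single_of_nat)
  show "CHAR('b) dvd n" if "of_nat n = (0 :: 'a \<Rightarrow>\<^sub>0 'b)" for n
    using that by (metis lookup_of_nat lookup_zero of_nat_eq_0_iff_char_dvd when_simps(1))
qed

text \<open>The target varies: polynomials over polynomials for the change of coordinates and for
  division by the quartic, the field for the value at the origin, univariate polynomials for
  restriction to an axis.\<close>

locale evaluation =
  fixes \<phi> :: "'k::comm_ring_1 \<Rightarrow> 'c::comm_ring_1" and v :: "'i::finite \<Rightarrow> 'c"
  assumes phi_0: "\<phi> 0 = 0" and phi_1: "\<phi> 1 = 1"
    and phi_add: "\<phi> (a + b) = \<phi> a + \<phi> b" and phi_mult: "\<phi> (a * b) = \<phi> a * \<phi> b"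
begin

definition ev :: "(('i \<Rightarrow>\<^sub>0 nat) \<Rightarrow>\<^sub>0 'k) \<Rightarrow> 'c" where
  "ev h = (\<Sum>m\<in>Poly_Mapping.keys h.
             \<phi> (Poly_Mapping.lookup h m) * (\<Prod>i\<in>UNIV. v i ^ Poly_Mapping.lookup m i))"

text \<open>Summands outside the support vanish by \<open>phi_0\<close>, so several polynomials can
  be summed over a common index set; this gives additivity.\<close>

lemma ev_superset:
  assumes "finite A" "Poly_Mapping.keys h \<subseteq> A"
  shows "ev h = (\<Sum>m\<in>A. \<phi> (Poly_Mapping.lookup h m) * (\<Prod>i\<in>UNIV. v i ^ Poly_Mapping.lookup m i))"
  unfolding ev_def using assms
  by (intro sum.mono_neutral_left) (auto simp: in_keys_iff phi_0)

lemma ev_add: "ev (h + h') = ev h + ev h'"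
proof -
  let ?A = "Poly_Mapping.keys h \<union> Poly_Mapping.keys h'"
  show ?thesis
    using keys_add[of h h']
    by (subst (1 2 3) ev_superset[of ?A])
      (auto simp: lookup_add phi_add algebra_simps sum.distrib)
qed

lemma ev_single: "ev (Poly_Mapping.single m a) = \<phi> a * (\<Prod>i\<in>UNIV. v i ^ Poly_Mapping.lookup m i)"
  by (subst ev_superset[of "{m}"]) auto

lemma ev_0: "ev 0 = 0"
  by (simp add: ev_def)

lemma ev_1: "ev 1 = 1"
  by (simp add: ev_single phi_1 flip: single_one)

lemma ev_mult: "ev (h * h') = ev h * ev h'"
proof (induction h rule: poly_mapping_induct_single)
  case (single m a)
  show ?case
    by (induction h' rule: poly_mapping_induct_single)
      (simp_all add: mult_single ev_single ev_add phi_mult lookup_add power_add prod.distrib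
        algebra_simps)
qed (simp add: ev_add algebra_simps)

lemma ev_minus: "ev (- h) = - ev h"
  using ev_add[of h "- h"] by (simp add: ev_0 eq_neg_iff_add_eq_0 add.commute)

lemma ev_diff: "ev (h - h') = ev h - ev h'"
  using ev_add[of h "- h'"] by (simp add: ev_minus)

lemma ev_power: "ev (h ^ n) = ev h ^ n"
  by (induction n) (simp_all add: ev_1 ev_mult)

lemma ev_sum: "ev (sum F A) = (\<Sum>x\<in>A. ev (F x))"
  by (induction A rule: infinite_finite_induct) (simp_all add: ev_0 ev_add)

lemma ev_const: "ev (Poly_Mapping.single 0 a) = \<phi> a"
  by (simp add: ev_single)

lemma ev_single_single: "ev (Poly_Mapping.single (Poly_Mapping.single i 1) 1) = v i"
proof -
  have "(\<Prod>j\<in>UNIV. v j ^ Poly_Mapping.lookup (Poly_Mapping.single i 1) j)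
      = (\<Prod>j\<in>UNIV. if j = i then v j else 1)"
    by (rule prod.cong) (auto simp: lookup_single when_def)
  then show ?thesis
    by (simp add: ev_single phi_1)
qed

end

section \<open>Monomials as products of powers of the variables\<close>

lemma single_power:
  "Poly_Mapping.single m (a :: 'b::comm_semiring_1) ^ n
     = Poly_Mapping.single (((+) m ^^ n) (0 :: 'a::comm_monoid_add)) (a ^ n)"
  by (induction n) (simp_all add: mult_single)

lemma single_funpow_add:
  "((+) (Poly_Mapping.single i (k :: nat)) ^^ n) 0 = Poly_Mapping.single i (n * k)"
  by (induction n) (simp_all flip: single_add)

lemma prod_single:
  "(\<Prod>i\<in>A. Poly_Mapping.single (F i) (1 :: 'b::comm_semiring_1))
     = Poly_Mapping.single (\<Sum>i\<in>A. F i :: 'a::comm_monoid_add) 1"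
  by (induction A rule: infinite_finite_induct) (simp_all add: mult_single)

lemma sum_single_lookup:
  "(\<Sum>i\<in>UNIV. Poly_Mapping.single i (Poly_Mapping.lookup m i)) = (m :: 'i::finite \<Rightarrow>\<^sub>0 'b::comm_monoid_add)"
  by (rule poly_mapping_eqI) (simp add: lookup_sum lookup_single when_def)

lemma prod_poly_var:
  "(\<Prod>i\<in>UNIV. poly_var i ^ Poly_Mapping.lookup m i) = Poly_Mapping.single m (1 :: 'k::field)"
  by (simp add: poly_var_def single_power single_funpow_add prod_single sum_single_lookup
      del: One_nat_def)

lemma single_eq_const_mult_vars:
  "Poly_Mapping.single m (a :: 'k::field)
     = Poly_Mapping.single 0 a * (\<Prod>i\<in>UNIV. poly_var i ^ Poly_Mapping.lookup m i)"
  by (simp add: prod_poly_var mult_single)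

text \<open>Constants and variables generate the ring. This serves to recognise one substitution as
  a left inverse of another.\<close>

lemma poly5_hom_eq_id:
  fixes F :: "'k::field poly5 \<Rightarrow> 'k poly5"
  assumes add: "\<And>h h'. F (h + h') = F h + F h'" and mult: "\<And>h h'. F (h * h') = F h * F h'"
    and const: "\<And>a. F (Poly_Mapping.single 0 a) = Poly_Mapping.single 0 a"
    and var: "\<And>i. F (poly_var i) = poly_var i"
  shows "F h = h"
proof (induction h rule: poly_mapping_induct_single)
  case (single m a)
  have one: "F 1 = 1"
    using const[of 1] by simp
  have pow: "F (g ^ n) = F g ^ n" for g n
    by (induction n) (simp_all add: one mult)
  have "F (\<Prod>i\<in>A. poly_var i ^ Poly_Mapping.lookup m i) = (\<Prod>i\<in>A. poly_var i ^ Poly_Mapping.lookup m i)"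
    for A
    by (induction A rule: infinite_finite_induct) (simp_all add: one mult pow var)
  then show ?case
    by (simp add: single_eq_const_mult_vars[of m a] mult const)
qed (simp add: add)

section \<open>The quartic as a polynomial in one of its variables\<close>

definition quartic_rest :: "5 \<Rightarrow> 'k::field poly5" where
  "quartic_rest i = (\<Sum>j\<in>UNIV - {i}. poly_var j ^ 4)"

definition quartic :: "'k::field poly5" where
  "quartic = (\<Sum>i\<in>UNIV. poly_var i ^ 4)"

lemma quartic_split: "quartic = poly_var i ^ 4 + quartic_rest i"
  by (simp add: quartic_def quartic_rest_def sum.remove[of UNIV i])

text \<open>Naming the other four variables turns \<open>quartic_rest i\<close> into an explicit sum
  of four fourth powers.\<close>

lemma obtain_other_indices:
  fixes i :: 5
  obtains a b c d where "distinct [a, b, c, d, i]" "UNIV - {i} = {a, b, c, d}"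
proof -
  have "card (UNIV - {i}) = 4"
    by (simp add: card_Diff_singleton)
  moreover obtain xs where xs: "set xs = UNIV - {i}" "distinct xs"
    using finite_distinct_list[of "UNIV - {i}"] by auto
  ultimately have "length xs = 4"
    by (metis distinct_card)
  then obtain a b c d where "xs = [a, b, c, d]"
    by (auto simp: numeral_eq_Suc length_Suc_conv)
  with xs show thesis
    by (intro that[of a b c d]) auto
qed

section \<open>Neither \<open>quartic_rest i\<close> nor its negative is a square\<close>

lemma linear_poly_power_4:
  "[:x, y:] ^ 4 = [:x ^ 4, 4 * y * x ^ 3, 6 * y\<^sup>2 * x\<^sup>2, 4 * y ^ 3 * x, y ^ 4 :: 'a::comm_ring_1:]"
proof -
  have "[:x, y:]\<^sup>2 = [:x\<^sup>2, 2 * (x * y), y\<^sup>2:]"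
    by (simp add: power2_eq_square algebra_simps)
  moreover have "[:x, y:] ^ 4 = ([:x, y:]\<^sup>2)\<^sup>2"
    by (simp flip: power_mult)
  moreover have "[:x\<^sup>2, 2 * (x * y), y\<^sup>2:]\<^sup>2
      = [:x ^ 4, 4 * y * x ^ 3, 6 * y\<^sup>2 * x\<^sup>2, 4 * y ^ 3 * x, y ^ 4:]"
    unfolding power2_eq_square[of "[:_, _, _:]"]
    by (simp add: power4_eq_xxxx power3_eq_cube power2_eq_square mult_ac)
  ultimately show ?thesis
    by simp
qed

text \<open>Since \<open>1 + 2\<^sup>4 + 3\<^sup>4 = 98\<close> vanishes in characteristic 7, the hypersurface
  \<open>g = 0\<close> contains a rational point.  Along the lines through it \<open>g\<close> has odd degree,
  so that neither \<open>g\<close> nor \<open>-g\<close> is a square in the field of fractions.\<close>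
lemma quartic_rest_line:
  fixes i :: 5
  assumes char: "CHAR('k::field) = 7"
  obtains E :: "'k::field poly5 \<Rightarrow> 'k poly5 poly"
  where "\<And>h h'. E (h + h') = E h + E h'" "\<And>h h'. E (h * h') = E h * E h'" "inj E"
    "Polynomial.degree (E (quartic_rest i)) = 3"
proof -
  obtain a b c d where abcd: "distinct [a, b, c, d, i]" "UNIV - {i} = {a, b, c, d}"
    by (rule obtain_other_indices)
  \<comment> \<open>The parameter \<open>t\<close> of the line replaces \<open>x_a\<close>, while
    \<open>x_b\<close> and \<open>x_c\<close> become \<open>x_b + 2 t\<close> and
    \<open>x_c + 3 t\<close>: the direction is the rational point (1,2,3,0).\<close>
  define v :: "5 \<Rightarrow> 'k poly5 poly" where
    "v = (\<lambda>j. [:poly_var j:])(a := [:0, 1:], b := [:poly_var b, 2:], c := [:poly_var c, 3:])"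
  \<comment> \<open>Setting \<open>t\<close> to \<open>x_a\<close> and then substituting
    \<open>w\<close> undoes \<open>v\<close>, which makes the restriction to the line
    injective.\<close>
  define w :: "5 \<Rightarrow> 'k poly5" where
    "w = poly_var(b := poly_var b - 2 * poly_var a, c := poly_var c - 3 * poly_var a)"
  interpret E: evaluation "\<lambda>a. [:Poly_Mapping.single 0 a:]" v
    by standard (simp_all add: single_add mult_single mult.commute)
  interpret T: evaluation "Poly_Mapping.single 0" w
    by standard (simp_all add: single_add mult_single)
  have E_var: "E.ev (poly_var j) = v j" and T_var: "T.ev (poly_var j) = w j" for j
    unfolding poly_var_def by (rule E.ev_single_single T.ev_single_single)+
  have v: "v j = (if j = c then [:poly_var c, 3:] else if j = b then [:poly_var b, 2:]
      else if j = a then [:0, 1:] else [:poly_var j:])"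
    and w: "w j = (if j = c then poly_var c - 3 * poly_var a
      else if j = b then poly_var b - 2 * poly_var a else poly_var j)" for j
    by (simp_all add: v_def w_def)
  have T_2: "T.ev 2 = 2" and T_3: "T.ev 3 = 3"
    by (simp_all add: T.ev_const flip: single_numeral)
  have T_E_var: "T.ev (poly (E.ev (poly_var j)) (poly_var a)) = poly_var j" for j
  proof -
    have neq: "a \<noteq> b" "a \<noteq> c" "b \<noteq> c"
      using abcd(1) by auto
    consider "j = c" | "j = b" | "j = a" | "j \<notin> {a, b, c}"
      by blast
    then show ?thesis
    proof cases
      case 1
      show ?thesis
        unfolding 1 E_var v by (simp add: T.ev_add T.ev_mult T_3 T_var w neq)
    next
      case 2
      show ?thesis
        unfolding 2 E_var v using neq by (simp add: T.ev_add T.ev_mult T_2 T_var w)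
    next
      case 3
      show ?thesis
        unfolding 3 E_var v using neq by (simp add: T_var w)
    next
      case 4
      then show ?thesis
        unfolding E_var v by (simp add: T_var w)
    qed
  qed
  have "T.ev (poly (E.ev h) (poly_var a)) = h" for h
    by (rule poly5_hom_eq_id[where F = "\<lambda>h. T.ev (poly (E.ev h) (poly_var a))"])
      (simp_all add: E.ev_add E.ev_mult T.ev_add T.ev_mult E.ev_const T.ev_const T_E_var)
  then have inj: "inj E.ev"
    by (rule inj_on_inverseI)
  have char': "CHAR('k poly5) = 7"
    by (simp add: char CHAR_poly_mapping)
  have z: "of_nat (7 * n) = (0 :: 'k poly5)" for n
    using of_nat_CHAR[where 'a = "'k poly5"] char' by simp
  have z98: "(98 :: 'k poly5) = 0"
    using z[of 14] by simp
  have "E.ev (quartic_rest i) = [:0, 1:] ^ 4 + [:poly_var b, 2:] ^ 4 + [:poly_var c, 3:] ^ 4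
      + [:poly_var d:] ^ 4"
    using abcd(1) unfolding quartic_rest_def abcd(2)
    by (auto simp: E.ev_add E.ev_power E_var v add_ac)
  also have "\<dots> = [:poly_var b ^ 4 + poly_var c ^ 4 + poly_var d ^ 4,
      8 * poly_var b ^ 3 + 12 * poly_var c ^ 3, 24 * poly_var b ^ 2 + 54 * poly_var c ^ 2,
      32 * poly_var b + 108 * poly_var c, 98:]"
    by (simp add: linear_poly_power_4 poly_const_pow add_ac)
  finally have E_rest: "E.ev (quartic_rest i) = [:poly_var b ^ 4 + poly_var c ^ 4 + poly_var d ^ 4,
      8 * poly_var b ^ 3 + 12 * poly_var c ^ 3, 24 * poly_var b ^ 2 + 54 * poly_var c ^ 2,
      32 * poly_var b + 108 * poly_var c:]"
    by (simp add: z98)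
  \<comment> \<open>The quartic coefficient 98 is 0. The cubic one is not: 32 is prime to 7, and the
    term in \<open>x_c\<close> cannot cancel the one in \<open>x_b\<close>.\<close>
  have "(32 :: 'k) \<noteq> 0"
    using of_nat_eq_0_iff_char_dvd[where 'a = 'k, of 32] char by simp
  moreover have "Poly_Mapping.single c (Suc 0) \<noteq> Poly_Mapping.single b (Suc 0)"
    using abcd(1) by (auto simp: poly_mapping_eq_iff lookup_single fun_eq_iff when_def)
  then have "Poly_Mapping.lookup (32 * poly_var b + 108 * poly_var c :: 'k poly5)
      (Poly_Mapping.single b 1) = 32"
    by (simp add: poly_var_def lookup_add mult_single lookup_single when_def flip: single_numeral)
  ultimately have "32 * poly_var b + 108 * poly_var c \<noteq> (0 :: 'k poly5)"
    by (metis lookup_zero)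
  then have "Polynomial.degree (E.ev (quartic_rest i)) = 3"
    unfolding E_rest by simp
  with inj show thesis
    by (intro that[of E.ev]) (simp_all add: E.ev_add E.ev_mult)
qed

text \<open>If \<open>b\<close> were nonzero, the left side would have even degree and the right
  side odd degree.\<close>

lemma square_eq_odd_degree_mult_square:
  fixes a b g :: "'a::idom poly"
  assumes "odd (Polynomial.degree g)" "a\<^sup>2 = g * b\<^sup>2"
  shows "b = 0"
proof (rule ccontr)
  assume b: "b \<noteq> 0"
  have g: "g \<noteq> 0"
    using assms(1) by auto
  have a: "a \<noteq> 0"
    using assms(2) b g by auto
  have "2 * Polynomial.degree a = Polynomial.degree g + 2 * Polynomial.degree b"
    using arg_cong[OF assms(2), of Polynomial.degree] a b g
    by (simp add: degree_mult_eq degree_power_eq)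
  then show False
    using assms(1) by (metis even_add even_mult_iff even_numeral)
qed

text \<open>Both alternatives are carried to the line, where parity of degrees applies to the
  restricted form and to its negative; injectivity brings \<open>b = 0\<close> back.\<close>

lemma square_eq_quartic_rest_mult_square:
  fixes a b :: "'k::field poly5"
  assumes char: "CHAR('k) = 7" and eq: "a\<^sup>2 = quartic_rest i * b\<^sup>2 \<or> a\<^sup>2 + quartic_rest i * b\<^sup>2 = 0"
  shows "a = 0 \<and> b = 0"
proof -
  obtain E :: "'k poly5 \<Rightarrow> 'k poly5 poly"
    where E: "\<And>h h'. E (h + h') = E h + E h'" "\<And>h h'. E (h * h') = E h * E h'" "inj E"
    and deg: "Polynomial.degree (E (quartic_rest i)) = 3"
    using quartic_rest_line[OF char] by blast
  have E0: "E 0 = 0"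
    using E(1)[of 0 0] by (metis add.right_neutral add_left_imp_eq)
  have "(E a)\<^sup>2 = E (quartic_rest i) * (E b)\<^sup>2 \<or> (E a)\<^sup>2 = (- E (quartic_rest i)) * (E b)\<^sup>2"
    using eq
  proof
    assume "a\<^sup>2 = quartic_rest i * b\<^sup>2"
    then show ?thesis
      by (metis E(2) power2_eq_square)
  next
    assume "a\<^sup>2 + quartic_rest i * b\<^sup>2 = 0"
    then have "(E a)\<^sup>2 + E (quartic_rest i) * (E b)\<^sup>2 = 0"
      by (metis E(1,2) E0 power2_eq_square)
    then show ?thesis
      by (simp add: eq_neg_iff_add_eq_0)
  qed
  then have "E b = 0"
  proof
    assume "(E a)\<^sup>2 = E (quartic_rest i) * (E b)\<^sup>2"
    then show ?thesis
      by (rule square_eq_odd_degree_mult_square[rotated]) (simp add: deg)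
  next
    assume "(E a)\<^sup>2 = (- E (quartic_rest i)) * (E b)\<^sup>2"
    then show ?thesis
      by (rule square_eq_odd_degree_mult_square[rotated]) (simp add: deg)
  qed
  then have "b = 0"
    using injD[OF E(3), of b 0] E0 by simp
  with eq show ?thesis
    by auto
qed

section \<open>Division with remainder by the quartic, norms, and primality\<close>

definition free_of :: "'i \<Rightarrow> (('i \<Rightarrow>\<^sub>0 nat) \<Rightarrow>\<^sub>0 'k::zero) \<Rightarrow> bool" where
  "free_of i h \<longleftrightarrow> (\<forall>m\<in>Poly_Mapping.keys h. Poly_Mapping.lookup m i = 0)"

lemma free_of_single: "Poly_Mapping.lookup m i = 0 \<Longrightarrow> free_of i (Poly_Mapping.single m a)"
  by (simp add: free_of_def)

lemma free_of_0: "free_of i 0"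
  by (simp add: free_of_def)

lemma free_of_numeral: "free_of i (numeral n :: _ \<Rightarrow>\<^sub>0 'k::semiring_1)"
  unfolding single_numeral[symmetric] by (intro free_of_single) simp

lemma free_of_1: "free_of i (1 :: _ \<Rightarrow>\<^sub>0 'k::semiring_1)"
  unfolding single_one[symmetric] by (intro free_of_single) simp

lemma free_of_add: "free_of i a \<Longrightarrow> free_of i b \<Longrightarrow> free_of i (a + b)"
  using keys_add[of a b] by (auto simp: free_of_def)

lemma free_of_uminus: "free_of i a \<Longrightarrow> free_of i (- a)"
  by (auto simp: free_of_def in_keys_iff)

lemma free_of_diff:
  fixes a b :: "('i \<Rightarrow>\<^sub>0 nat) \<Rightarrow>\<^sub>0 'k::ab_group_add"
  shows "free_of i a \<Longrightarrow> free_of i b \<Longrightarrow> free_of i (a - b)"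
  using free_of_add[of i a "- b"] by (simp add: free_of_uminus)

lemma free_of_mult: "free_of i a \<Longrightarrow> free_of i b \<Longrightarrow> free_of i (a * b)"
  using keys_mult[of a b] by (fastforce simp: free_of_def lookup_add)

lemma free_of_power:
  fixes a :: "('i \<Rightarrow>\<^sub>0 nat) \<Rightarrow>\<^sub>0 'k::semiring_1"
  shows "free_of i a \<Longrightarrow> free_of i (a ^ n)"
  by (induction n) (simp_all add: free_of_1 free_of_mult)

lemma free_of_sum: "(\<And>x. x \<in> A \<Longrightarrow> free_of i (F x)) \<Longrightarrow> free_of i (sum F A)"
  by (induction A rule: infinite_finite_induct) (simp_all add: free_of_0 free_of_add)

lemma free_of_quartic_rest: "free_of i (quartic_rest i :: 'k::field poly5)"
  unfolding quartic_rest_def poly_var_def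
  by (intro free_of_sum free_of_power free_of_single) (auto simp: lookup_single when_def)

lemmas free_of_intros = free_of_add free_of_diff free_of_uminus free_of_mult free_of_power
  free_of_numeral free_of_quartic_rest

text \<open>The quartic is monic of degree 4 in \<open>poly_var i\<close>. Replacing
  \<open>poly_var i ^ 4\<close> by \<open>- quartic_rest i\<close> lowers the exponent by 4 and
  changes the coefficient, hence the induction over all \<open>c\<close>.\<close>

lemma quartic_division_monomial:
  fixes c :: "'k::field poly5"
  assumes "free_of i c"
  shows "\<exists>c0 c1 c2 c3. free_of i c0 \<and> free_of i c1 \<and> free_of i c2 \<and> free_of i c3 \<and>
    quartic dvd c * poly_var i ^ n
      - (c0 + c1 * poly_var i + c2 * poly_var i ^ 2 + c3 * poly_var i ^ 3)"
  using assms
proof (induction n arbitrary: c rule: less_induct)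
  case (less n)
  let ?x = "poly_var i :: 'k poly5"
  consider "n = 0" | "n = 1" | "n = 2" | "n = 3" | "n \<ge> 4"
    by linarith
  then show ?case
  proof cases
    case 5
    then obtain k where k: "n = k + 4"
      by (metis add.commute le_Suc_ex)
    have "free_of i (- c * quartic_rest i)"
      using less.prems by (intro free_of_intros)
    from less.IH[OF _ this, of k] k obtain c0 c1 c2 c3 where
      c: "free_of i c0" "free_of i c1" "free_of i c2" "free_of i c3"
        "quartic dvd (- c * quartic_rest i) * ?x ^ k - (c0 + c1 * ?x + c2 * ?x ^ 2 + c3 * ?x ^ 3)"
      by auto
    have "c * ?x ^ n - (c0 + c1 * ?x + c2 * ?x ^ 2 + c3 * ?x ^ 3)
      = quartic * (c * ?x ^ k)
        + ((- c * quartic_rest i) * ?x ^ k - (c0 + c1 * ?x + c2 * ?x ^ 2 + c3 * ?x ^ 3))"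
      by (simp add: k quartic_split[of i] power_add algebra_simps)
    then have "quartic dvd c * ?x ^ n - (c0 + c1 * ?x + c2 * ?x ^ 2 + c3 * ?x ^ 3)"
      using c(5) by (metis dvd_add dvd_triv_left)
    with c show ?thesis
      by blast
  next
    case 1
    show ?thesis
      by (rule exI[of _ c], rule exI[of _ 0], rule exI[of _ 0], rule exI[of _ 0])
        (use less.prems 1 in \<open>simp add: free_of_0\<close>)
  next
    case 2
    show ?thesis
      by (rule exI[of _ 0], rule exI[of _ c], rule exI[of _ 0], rule exI[of _ 0])
        (use less.prems 2 in \<open>simp add: free_of_0\<close>)
  next
    case 3
    show ?thesis
      by (rule exI[of _ 0], rule exI[of _ 0], rule exI[of _ c], rule exI[of _ 0])
        (use less.prems 3 in \<open>simp add: free_of_0\<close>)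
  next
    case 4
    show ?thesis
      by (rule exI[of _ 0], rule exI[of _ 0], rule exI[of _ 0], rule exI[of _ c])
        (use less.prems 4 in \<open>simp add: free_of_0\<close>)
  qed
qed

text \<open>Remainders add up, and each single term is a term free of \<open>poly_var i\<close>
  times a power of \<open>poly_var i\<close>.\<close>

lemma quartic_division:
  fixes h :: "'k::field poly5"
  shows "\<exists>c0 c1 c2 c3. free_of i c0 \<and> free_of i c1 \<and> free_of i c2 \<and> free_of i c3 \<and>
    quartic dvd h - (c0 + c1 * poly_var i + c2 * poly_var i ^ 2 + c3 * poly_var i ^ 3)"
proof (induction h rule: poly_mapping_induct_single)
  case (single m a)
  let ?n = "Poly_Mapping.lookup m i"
  let ?m = "m - Poly_Mapping.single i ?n"
  have "?m + Poly_Mapping.single i ?n = m"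
    by (rule poly_mapping_eqI) (auto simp: lookup_add lookup_minus lookup_single when_def)
  then have "Poly_Mapping.single m a = Poly_Mapping.single ?m a * poly_var i ^ ?n"
    by (simp add: poly_var_def single_power single_funpow_add mult_single del: One_nat_def)
  moreover have "free_of i (Poly_Mapping.single ?m a)"
    by (intro free_of_single) (simp add: lookup_minus)
  ultimately show ?case
    using quartic_division_monomial[of i "Poly_Mapping.single ?m a" ?n] by simp
next
  case (add h h')
  then obtain c0 c1 c2 c3 d0 d1 d2 d3 where
    c: "free_of i c0" "free_of i c1" "free_of i c2" "free_of i c3"
      "quartic dvd h - (c0 + c1 * poly_var i + c2 * poly_var i ^ 2 + c3 * poly_var i ^ 3)"
    and d: "free_of i d0" "free_of i d1" "free_of i d2" "free_of i d3"
      "quartic dvd h' - (d0 + d1 * poly_var i + d2 * poly_var i ^ 2 + d3 * poly_var i ^ 3)"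
    by blast
  have eq: "h + h' - ((c0 + d0) + (c1 + d1) * poly_var i + (c2 + d2) * poly_var i ^ 2
      + (c3 + d3) * poly_var i ^ 3)
    = (h - (c0 + c1 * poly_var i + c2 * poly_var i ^ 2 + c3 * poly_var i ^ 3))
      + (h' - (d0 + d1 * poly_var i + d2 * poly_var i ^ 2 + d3 * poly_var i ^ 3))"
    by (simp add: algebra_simps)
  have dvd: "quartic dvd h + h' - ((c0 + d0) + (c1 + d1) * poly_var i + (c2 + d2) * poly_var i ^ 2
      + (c3 + d3) * poly_var i ^ 3)"
    unfolding eq by (rule dvd_add[OF c(5) d(5)])
  show ?case
    by (rule exI[of _ "c0 + d0"], rule exI[of _ "c1 + d1"], rule exI[of _ "c2 + d2"],
        rule exI[of _ "c3 + d3"]) (intro conjI free_of_add c d dvd)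
qed

text \<open>Uniqueness of the remainder: seen as a univariate polynomial in
  \<open>poly_var i\<close>, a nonzero multiple of the quartic has degree at least 4.\<close>

lemma quartic_dvd_reduced:
  fixes c0 c1 c2 c3 :: "'k::field poly5"
  assumes free: "free_of i c0" "free_of i c1" "free_of i c2" "free_of i c3"
    and dvd: "quartic dvd c0 + c1 * poly_var i + c2 * poly_var i ^ 2 + c3 * poly_var i ^ 3"
  shows "c0 = 0 \<and> c1 = 0 \<and> c2 = 0 \<and> c3 = 0"
proof -
  \<comment> \<open>The variable \<open>x_i\<close> becomes the indeterminate of the outer
    polynomial ring; polynomials free of it become constants.\<close>
  define v :: "5 \<Rightarrow> 'k poly5 poly" where "v = (\<lambda>j. if j = i then [:0, 1:] else [:poly_var j:])"
  interpret H: evaluation "\<lambda>a. [:Poly_Mapping.single 0 a:]" v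
    by standard (simp_all add: single_add mult_single mult.commute)
  have H_free: "H.ev h = [:h:]" if "free_of i h" for h
  proof -
    have const_prod: "(\<Prod>j\<in>A. [:F j:]) = [:\<Prod>j\<in>A. F j:]" for F :: "5 \<Rightarrow> 'k poly5" and A
      by (induction A rule: infinite_finite_induct) (simp_all add: mult.commute)
    have const_sum: "(\<Sum>m\<in>A. [:F m:]) = [:\<Sum>m\<in>A. F m:]"
      for F :: "(5 \<Rightarrow>\<^sub>0 nat) \<Rightarrow> 'k poly5" and A
      by (induction A rule: infinite_finite_induct) simp_all
    have "(\<Prod>j\<in>UNIV. v j ^ Poly_Mapping.lookup m j) = [:Poly_Mapping.single m 1:]"
      if "m \<in> Poly_Mapping.keys h" for m
    proof -
      have "(\<Prod>j\<in>UNIV. v j ^ Poly_Mapping.lookup m j)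
          = (\<Prod>j\<in>UNIV. [:poly_var j ^ Poly_Mapping.lookup m j:])"
        using \<open>free_of i h\<close> that
        by (intro prod.cong) (auto simp: free_of_def v_def poly_const_pow)
      then show ?thesis
        by (simp add: const_prod prod_poly_var)
    qed
    then have "H.ev h = (\<Sum>m\<in>Poly_Mapping.keys h. [:Poly_Mapping.single m (Poly_Mapping.lookup h m):])"
      unfolding H.ev_def by (intro sum.cong) (simp_all add: mult_single)
    then show ?thesis
      by (simp add: const_sum sum_single_keys)
  qed
  have H_var: "H.ev (poly_var i) = [:0, 1:]"
    unfolding poly_var_def H.ev_single_single by (simp add: v_def)
  have "[:0, 1:] ^ 4 = ([:0, 0, 0, 0, 1:] :: 'k poly5 poly)"
    by (simp add: power4_eq_xxxx)
  then have H_quartic: "H.ev quartic = [:quartic_rest i, 0, 0, 0, 1:]"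
    by (simp add: quartic_split[of i] H.ev_add H.ev_power H_var H_free free_of_quartic_rest)
  obtain r where r: "c0 + c1 * poly_var i + c2 * poly_var i ^ 2 + c3 * poly_var i ^ 3 = quartic * r"
    using dvd by auto
  have "[:c0, c1, c2, c3:] = [:quartic_rest i, 0, 0, 0, 1:] * H.ev r"
    using arg_cong[OF r, of H.ev] free
    by (simp add: H.ev_add H.ev_mult H.ev_power H_var H_free H_quartic power2_eq_square
        power3_eq_cube)
  moreover have "Polynomial.degree [:c0, c1, c2, c3:] < 4"
    by (simp add: degree_pCons_eq_if)
  moreover have "Polynomial.degree ([:quartic_rest i, 0, 0, 0, 1:] * p)
      = 4 + Polynomial.degree p" if "p \<noteq> 0" for p
    using that by (subst degree_mult_eq) auto
  ultimately have "H.ev r = 0"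
    by (metis not_add_less1)
  with \<open>[:c0, c1, c2, c3:] = _\<close> show ?thesis
    by simp
qed

text \<open>The norm of \<open>c0 + c1 y + c2 y\<^sup>2 + c3 y\<^sup>3\<close> over the subring of \<open>y\<close>-free elements, computed in
  two quadratic steps, from \<open>y\<close> to \<open>y\<^sup>2\<close> and from \<open>y\<^sup>2\<close> to \<open>y\<^sup>4 = -g\<close>.\<close>
lemma quartic_norm_identity:
  fixes c0 c1 c2 c3 y g :: "'a::comm_ring_1"
  defines "p \<equiv> c0\<^sup>2 - g * c2\<^sup>2 + 2 * g * c1 * c3"
    and "q \<equiv> 2 * c0 * c2 - c1\<^sup>2 + g * c3\<^sup>2"
  shows "(c0 + c1 * y + c2 * y ^ 2 + c3 * y ^ 3)
      * ((c0 - c1 * y + c2 * y ^ 2 - c3 * y ^ 3) * (p - q * y ^ 2)) - (p\<^sup>2 + g * q\<^sup>2)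
    = (y ^ 4 + g) * ((c2\<^sup>2 - 2 * c1 * c3 - c3\<^sup>2 * y\<^sup>2) * (p - q * y\<^sup>2) - q\<^sup>2)"
proof -
  \<comment> \<open>The quotient by \<open>y ^ 4 + g\<close> in the first step, where multiplying by
    the conjugate under \<open>y\<close> to \<open>- y\<close> leaves the remainder
    \<open>p + q y^2\<close>.\<close>
  let ?s = "c2\<^sup>2 - 2 * c1 * c3 - c3\<^sup>2 * y\<^sup>2"
  have "(c0 + c1 * y + c2 * y ^ 2 + c3 * y ^ 3) * (c0 - c1 * y + c2 * y ^ 2 - c3 * y ^ 3)
      = p + q * y\<^sup>2 + (y ^ 4 + g) * ?s"
    unfolding p_def q_def
    by (simp add: algebra_simps power2_eq_square power3_eq_cube power4_eq_xxxx)
  then have "(c0 + c1 * y + c2 * y ^ 2 + c3 * y ^ 3)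
      * ((c0 - c1 * y + c2 * y ^ 2 - c3 * y ^ 3) * (p - q * y ^ 2))
      = (p + q * y\<^sup>2 + (y ^ 4 + g) * ?s) * (p - q * y\<^sup>2)"
    by (simp only: mult.assoc[symmetric])
  moreover have "(p + q * y\<^sup>2 + (y ^ 4 + g) * s) * (p - q * y\<^sup>2) - (p\<^sup>2 + g * q\<^sup>2)
      = (y ^ 4 + g) * (s * (p - q * y\<^sup>2) - q\<^sup>2)" for s
    by (simp add: algebra_simps power2_eq_square power4_eq_xxxx)
  ultimately show ?thesis
    by simp
qed

text \<open>The multiple is the norm \<open>p^2 + g q^2\<close> of the remainder of
  \<open>h\<close>. It is nonzero because extracting square roots of \<open>- g\<close> and then of
  \<open>- g\<close> again stays irreducible: neither \<open>g\<close> nor \<open>- g\<close> is a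
  square of a fraction.\<close>

lemma ex_free_multiple:
  fixes h :: "'k::field poly5"
  assumes char: "CHAR('k) = 7" and h: "\<not> quartic dvd h"
  shows "\<exists>d a. free_of i a \<and> a \<noteq> 0 \<and> quartic dvd h * d - a"
proof -
  let ?x = "poly_var i :: 'k poly5" and ?g = "quartic_rest i :: 'k poly5"
  obtain c0 c1 c2 c3 where free: "free_of i c0" "free_of i c1" "free_of i c2" "free_of i c3"
    and hc: "quartic dvd h - (c0 + c1 * ?x + c2 * ?x ^ 2 + c3 * ?x ^ 3)"
    using quartic_division by blast
  define c where "c = c0 + c1 * ?x + c2 * ?x ^ 2 + c3 * ?x ^ 3"
  define p where "p = c0\<^sup>2 - ?g * c2\<^sup>2 + 2 * ?g * c1 * c3"
  define q where "q = 2 * c0 * c2 - c1\<^sup>2 + ?g * c3\<^sup>2"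
  define d where "d = (c0 - c1 * ?x + c2 * ?x ^ 2 - c3 * ?x ^ 3) * (p - q * ?x ^ 2)"
  have "free_of i (p\<^sup>2 + ?g * q\<^sup>2)"
    unfolding p_def q_def using free by (intro free_of_intros)
  moreover have "p\<^sup>2 + ?g * q\<^sup>2 \<noteq> 0"
  proof
    assume "p\<^sup>2 + ?g * q\<^sup>2 = 0"
    then have pq: "p = 0" "q = 0"
      using square_eq_quartic_rest_mult_square[OF char] by blast+
    \<comment> \<open>These are the two components of the square of \<open>c0 + c2 sqrt(-g)\<close>.
      Taking its norm in both forms shows that \<open>(c0^2 + g c2^2)^2\<close> is \<open>g\<close>
      times a square, so both squared expressions vanish.\<close>
    have re: "c0\<^sup>2 - ?g * c2\<^sup>2 = - (2 * ?g * c1 * c3)" and im: "2 * c0 * c2 = c1\<^sup>2 - ?g * c3\<^sup>2"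
      using pq unfolding p_def q_def by (simp_all add: eq_neg_iff_add_eq_0 algebra_simps)
    have "(c0\<^sup>2 + ?g * c2\<^sup>2)\<^sup>2 = (c0\<^sup>2 - ?g * c2\<^sup>2)\<^sup>2 + ?g * (2 * c0 * c2)\<^sup>2"
      by (simp add: algebra_simps power2_eq_square)
    also have "\<dots> = ?g * (c1\<^sup>2 + ?g * c3\<^sup>2)\<^sup>2"
      unfolding re im by (simp add: algebra_simps power2_eq_square)
    finally have "c0\<^sup>2 + ?g * c2\<^sup>2 = 0" "c1\<^sup>2 + ?g * c3\<^sup>2 = 0"
      using square_eq_quartic_rest_mult_square[OF char] by blast+
    then have "c0 = 0" "c1 = 0" "c2 = 0" "c3 = 0"
      using square_eq_quartic_rest_mult_square[OF char] by blast+
    with hc h show False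
      by simp
  qed
  moreover have "quartic dvd h * d - (p\<^sup>2 + ?g * q\<^sup>2)"
  proof -
    have "quartic dvd c * d - (p\<^sup>2 + ?g * q\<^sup>2)"
      unfolding c_def d_def p_def q_def quartic_norm_identity quartic_split[of i] by simp
    moreover have "quartic dvd (h - c) * d"
      using hc by (simp add: c_def)
    ultimately have "quartic dvd (c * d - (p\<^sup>2 + ?g * q\<^sup>2)) + (h - c) * d"
      by (rule dvd_add)
    then show ?thesis
      by (simp add: algebra_simps)
  qed
  ultimately show ?thesis
    by blast
qed

text \<open>The norm replaces \<open>b\<close> by a nonzero \<open>e\<close> free of one variable.
  Multiplying the remainder of \<open>a\<close> by \<open>e\<close> gives again a reduced remainder,
  now divisible by the quartic, hence zero.\<close>

lemma quartic_dvd_mult: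
  fixes a b :: "'k::field poly5"
  assumes char: "CHAR('k) = 7" and ab: "quartic dvd a * b"
  shows "quartic dvd a \<or> quartic dvd b"
proof (rule disjCI)
  assume nb: "\<not> quartic dvd b"
  obtain d e where e: "free_of 0 e" "e \<noteq> 0" "quartic dvd b * d - e"
    using ex_free_multiple[OF char nb] by blast
  obtain c0 c1 c2 c3 where free: "free_of 0 c0" "free_of 0 c1" "free_of 0 c2" "free_of 0 c3"
    and ac: "quartic dvd a - (c0 + c1 * poly_var 0 + c2 * poly_var 0 ^ 2 + c3 * poly_var 0 ^ 3)"
      (is "quartic dvd a - ?c")
    using quartic_division by blast
  have "quartic dvd a * b * d - (b * d - e) * a - e * (a - ?c)"
    using ab e(3) ac by (intro dvd_diff) auto
  also have "a * b * d - (b * d - e) * a - e * (a - ?c)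
      = e * c0 + e * c1 * poly_var 0 + e * c2 * poly_var 0 ^ 2 + e * c3 * poly_var 0 ^ 3"
    by (simp add: algebra_simps)
  finally have "quartic dvd
      e * c0 + e * c1 * poly_var 0 + e * c2 * poly_var 0 ^ 2 + e * c3 * poly_var 0 ^ 3" .
  then have "e * c0 = 0 \<and> e * c1 = 0 \<and> e * c2 = 0 \<and> e * c3 = 0"
    using free e(1) by (intro quartic_dvd_reduced[of 0] free_of_mult)
  with e(2) ac show "quartic dvd a"
    by simp
qed

section \<open>Operators inverse to a power of Frobenius\<close>

text \<open>\<open>lam\<close> is linear from the field with scalars acting through their
  \<open>Q\<close>-th powers to the field itself. It stands in for \<open>Q\<close>-th roots of
  coefficients, which may not exist since \<open>'k\<close> is not assumed perfect.\<close>

locale frobenius_linear =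
  fixes Q :: nat and lam :: "'k::field \<Rightarrow> 'k"
  assumes char: "CHAR('k) = 7" and Q: "\<exists>e. Q = 7 ^ e"
    and lam_add: "lam (a + b) = lam a + lam b" and lam_power_mult: "lam (b ^ Q * a) = b * lam a"
begin

lemma Q_pos: "Q > 0"
  using Q by auto

lemma lam_0: "lam 0 = 0"
  using lam_add[of 0 0] by (metis add.right_neutral add_left_imp_eq)

end

text \<open>By the additivity of Frobenius the twisted action is a vector space structure; a nonzero
  \<open>b\<close> is independent, so a functional with value 1 at \<open>b\<close> exists.\<close>

lemma ex_frobenius_linear:
  fixes b :: "'k::field"
  assumes char: "CHAR('k) = 7" and b: "b \<noteq> 0"
  shows "\<exists>lam. frobenius_linear (7 ^ e) lam \<and> lam b = 1"
proof -
  have frob: "(x + y) ^ 7 ^ e = x ^ 7 ^ e + y ^ 7 ^ e" for x y :: 'k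
    by (rule freshmans_dream'[where n = e]) (simp_all add: char)
  interpret V: vector_space "\<lambda>c a :: 'k. c ^ (7 ^ e) * a"
    by standard (simp_all add: algebra_simps frob)
  interpret W: vector_space "(*) :: 'k \<Rightarrow> _"
    by standard (simp_all add: algebra_simps)
  interpret VW: vector_space_pair "\<lambda>c a :: 'k. c ^ (7 ^ e) * a" "(*) :: 'k \<Rightarrow> _" ..
  have "V.independent {b}"
    using b by simp
  then obtain lam where "Vector_Spaces.linear (\<lambda>c a :: 'k. c ^ (7 ^ e) * a) (*) lam" and lam: "lam b = 1"
    using VW.linear_independent_extend[of "{b}" "\<lambda>_. 1"] by auto
  then interpret L: Vector_Spaces.linear "\<lambda>c a :: 'k. c ^ (7 ^ e) * a" "(*)" lam
    by simp
  have "frobenius_linear (7 ^ e) lam"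
    using char L.add L.scale by unfold_locales auto
  with lam show ?thesis
    by blast
qed

section \<open>Taking roots of the monomials in one residue class\<close>

lemma lookup_funpow_add:
  "Poly_Mapping.lookup (((+) m ^^ n) 0) i = n * (Poly_Mapping.lookup m i :: nat)"
  by (induction n) (simp_all add: lookup_add)

lemma lookup_map_div:
  "Poly_Mapping.lookup (Poly_Mapping.map (\<lambda>n. n div Q) k) i = Poly_Mapping.lookup k i div (Q :: nat)"
  by (simp add: Poly_Mapping.map.rep_eq when_def)

locale cartier = frobenius_linear Q lam for Q and lam :: "'k::field \<Rightarrow> 'k" +
  fixes r :: "5 \<Rightarrow> nat"
begin

text \<open>A Cartier operator: the coordinate of \<open>h\<close> at the monomial with exponents
  \<open>r\<close>, in the basis of monomials with exponents below \<open>Q\<close> over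
  \<open>Q\<close>-th powers of variables, with \<open>lam\<close> applied to coefficients.\<close>

definition cartier :: "'k poly5 \<Rightarrow> 'k poly5" where
  "cartier h = (\<Sum>k\<in>Poly_Mapping.keys h.
     if \<forall>i. Poly_Mapping.lookup k i mod Q = r i
     then Poly_Mapping.single (Poly_Mapping.map (\<lambda>n. n div Q) k) (lam (Poly_Mapping.lookup h k))
     else 0)"

lemma cartier_superset:
  assumes "finite A" "Poly_Mapping.keys h \<subseteq> A"
  shows "cartier h = (\<Sum>k\<in>A.
     if \<forall>i. Poly_Mapping.lookup k i mod Q = r i
     then Poly_Mapping.single (Poly_Mapping.map (\<lambda>n. n div Q) k) (lam (Poly_Mapping.lookup h k))
     else 0)"
  unfolding cartier_def using assms
  by (intro sum.mono_neutral_left) (auto simp: in_keys_iff lam_0)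

lemma cartier_add: "cartier (h + h') = cartier h + cartier h'"
proof -
  let ?A = "Poly_Mapping.keys h \<union> Poly_Mapping.keys h'"
  show ?thesis
    using keys_add[of h h']
    by (subst (1 2 3) cartier_superset[of ?A])
      (auto simp: lookup_add lam_add single_add simp flip: sum.distrib intro!: sum.cong)
qed

lemma cartier_single:
  "cartier (Poly_Mapping.single k b) =
     (if \<forall>i. Poly_Mapping.lookup k i mod Q = r i
      then Poly_Mapping.single (Poly_Mapping.map (\<lambda>n. n div Q) k) (lam b) else 0)"
  by (subst cartier_superset[of "{k}"]) auto

lemma cartier_0: "cartier 0 = 0"
  by (simp add: cartier_def)

lemma cartier_sum: "cartier (sum F A) = (\<Sum>x\<in>A. cartier (F x))"
  by (induction A rule: infinite_finite_induct) (simp_all add: cartier_0 cartier_add)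

lemma power_Q_add: "(s + t :: 'k poly5) ^ Q = s ^ Q + t ^ Q"
proof -
  obtain e where "Q = 7 ^ e"
    using Q by blast
  then show ?thesis
    using freshmans_dream'[where n = e and m = "7 ^ e" and x = s and y = t]
    by (simp add: CHAR_poly_mapping char)
qed

text \<open>Both sides are additive in \<open>s\<close> by Frobenius. For a single term, the factor
  \<open>s ^ Q\<close> shifts exponents by multiples of \<open>Q\<close> and so preserves residue
  classes.\<close>

lemma cartier_power_mult: "cartier (s ^ Q * h) = s * cartier h"
proof (induction s rule: poly_mapping_induct_single)
  case (single m a)
  show ?case
  proof (induction h rule: poly_mapping_induct_single)
    case (single k b)
    have "Poly_Mapping.map (\<lambda>n. n div Q) (((+) m ^^ Q) 0 + k) = m + Poly_Mapping.map (\<lambda>n. n div Q) k"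
      using Q_pos by (intro poly_mapping_eqI) (simp add: lookup_map_div lookup_add lookup_funpow_add)
    then show ?case
      by (simp add: single_power mult_single cartier_single lookup_add lookup_funpow_add
          lam_power_mult)
  qed (simp add: cartier_add algebra_simps)
qed (simp add: cartier_add power_Q_add algebra_simps)

lemma cartier_var_power_eq_0:
  assumes free: "free_of j h" and n: "n mod Q \<noteq> r j"
  shows "cartier (poly_var j ^ n * h) = 0"
proof -
  have "cartier (poly_var j ^ n * Poly_Mapping.single m (Poly_Mapping.lookup h m)) = 0"
    if "m \<in> Poly_Mapping.keys h" for m
  proof -
    have "Poly_Mapping.lookup (Poly_Mapping.single j n + m) j mod Q \<noteq> r j"
      using n free that by (simp add: lookup_add free_of_def)
    then show ?thesis
      by (auto simp: poly_var_def single_power single_funpow_add mult_single cartier_single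
          simp del: One_nat_def)
  qed
  then have "cartier (poly_var j ^ n *
      (\<Sum>m\<in>Poly_Mapping.keys h. Poly_Mapping.single m (Poly_Mapping.lookup h m))) = 0"
    by (simp add: sum_distrib_left cartier_sum)
  then show ?thesis
    by (simp add: sum_single_keys)
qed

text \<open>This peels off one variable: the summand with index \<open>k\<close> has exponent
  \<open>4 * k + s\<close> in \<open>poly_var j\<close>, and only \<open>k0\<close> can meet the
  selected residue.\<close>

lemma cartier_binomial:
  assumes free: "free_of j h" "free_of j w" and k0: "k0 \<le> n"
    and k: "\<And>k. k \<le> n \<Longrightarrow> k \<noteq> k0 \<Longrightarrow> (4 * k + s) mod Q \<noteq> r j"
  shows "cartier ((poly_var j ^ 4 + h) ^ n * (poly_var j ^ s * w))
    = cartier (of_nat (n choose k0) * poly_var j ^ (4 * k0 + s) * h ^ (n - k0) * w)"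
proof -
  let ?t = "\<lambda>k. of_nat (n choose k) * poly_var j ^ (4 * k + s) * h ^ (n - k) * w"
  have "(poly_var j ^ 4 + h) ^ n * (poly_var j ^ s * w) = (\<Sum>k\<le>n. ?t k)"
    by (simp add: binomial_ring sum_distrib_right sum_distrib_left power_add mult_ac flip: power_mult)
  moreover have "cartier (?t k) = 0" if "k \<in> {..n} - {k0}" for k
  proof -
    have "free_of j (of_nat (n choose k) * h ^ (n - k) * w)"
      using free unfolding single_of_nat[symmetric]
      by (intro free_of_intros free_of_single) simp_all
    from cartier_var_power_eq_0[OF this, of "4 * k + s"] k[of k] that show ?thesis
      by (simp add: mult_ac)
  qed
  ultimately show ?thesis
    using k0 by (simp add: cartier_sum cartier_add sum.remove[of "{..n}" k0])
qed

end

text \<open>The last condition makes \<open>\<Psi>\<close> descend to the hypersurface ring.\<close>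
definition inverse_linear :: "nat \<Rightarrow> ('k::field poly5 \<Rightarrow> 'k poly5) \<Rightarrow> bool" where
  "inverse_linear Q \<Psi> \<longleftrightarrow> (\<forall>h h'. \<Psi> (h + h') = \<Psi> h + \<Psi> h') \<and> (\<forall>s h. \<Psi> (s ^ Q * h) = s * \<Psi> h)
     \<and> (\<forall>h. quartic dvd h \<longrightarrow> quartic dvd \<Psi> h)"

text \<open>The factor \<open>quartic ^ (Q - 1)\<close> turns a multiple of the quartic into a
  multiple of its \<open>Q\<close>-th power, from which one factor \<open>quartic\<close> comes out
  of the operator.\<close>

lemma (in cartier) inverse_linear_cartier:
  "inverse_linear Q (\<lambda>h. cartier (quartic ^ (Q - 1) * h))"
proof -
  have "quartic dvd cartier (quartic ^ (Q - 1) * h)" if "quartic dvd h" for h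
  proof -
    from that obtain t where t: "h = quartic * t" ..
    have "quartic ^ (Q - 1) * h = quartic ^ Q * t"
      using Q_pos by (simp add: t power_eq_if)
    then show ?thesis
      by (simp add: cartier_power_mult)
  qed
  moreover have "cartier (quartic ^ (Q - 1) * (s ^ Q * h)) = s * cartier (quartic ^ (Q - 1) * h)"
    for s h
    using cartier_power_mult[of s "quartic ^ (Q - 1) * h"] by (simp add: mult_ac)
  ultimately show ?thesis
    by (simp add: inverse_linear_def distrib_left cartier_add)
qed

section \<open>Operators with prescribed values\<close>

lemma ex_inverse_linear_cube_to_var:
  assumes char: "CHAR('k::field) = 7"
  shows "\<exists>\<Psi>. inverse_linear 7 \<Psi> \<and> \<Psi> (poly_var i ^ 3) = (poly_var i :: 'k poly5)"
proof -
  obtain a b c d where abcd: "distinct [a, b, c, d, i]" "UNIV - {i} = {a, b, c, d}"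
    by (rule obtain_other_indices)
  \<comment> \<open>360 is the coefficient of \<open>x_i^8 x_a^4 x_b^4 x_c^4 x_d^4\<close> in the
    sixth power of the quartic. Normalising \<open>lam\<close> there makes the result exactly
    \<open>x_i\<close>.\<close>
  have "(360 :: 'k) \<noteq> 0"
    using of_nat_eq_0_iff_char_dvd[where 'a = 'k, of 360] char by simp
  then obtain lam where "frobenius_linear (7 ^ 1) lam" and lam: "lam (360 :: 'k) = 1"
    using ex_frobenius_linear[OF char] by blast
  then interpret frobenius_linear 7 lam
    by simp
  interpret cartier 7 lam "\<lambda>_. 4" ..
  let ?x = "poly_var :: 5 \<Rightarrow> 'k poly5"
  have small: "k = 0 \<or> k = 1 \<or> k = 2 \<or> k = 3 \<or> k = 4 \<or> k = 5 \<or> k = 6" if "k \<le> 6" for k :: nat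
    using that by linarith
  \<comment> \<open>Each of the other four variables starts with exponent 0, and \<open>4 k\<close>
    is 4 modulo 7 only for \<open>k = 1\<close> in this range.\<close>
  have mod: "(4 * k + 0) mod 7 \<noteq> (4 :: nat)" if "k \<le> 4" "k \<noteq> 1" for k
    using small[of k] that by auto
  have free_var: "free_of j (?x l)" if "j \<noteq> l" for j l
    using that unfolding poly_var_def by (intro free_of_single) (simp add: lookup_single)
  note intros = free_of_intros free_of_1 free_var
  have rest: "quartic_rest i = ?x a ^ 4 + (?x b ^ 4 + (?x c ^ 4 + ?x d ^ 4))"
    using abcd by (simp add: quartic_rest_def)
  have "cartier (quartic ^ 6 * ?x i ^ 3)
      = cartier ((?x i ^ 4 + quartic_rest i) ^ 6 * (?x i ^ 3 * 1))"
    by (simp add: quartic_split[of i])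
  \<comment> \<open>With the extra factor \<open>x_i^3\<close>, the exponent \<open>4 k + 3\<close>
    is 4 modulo 7 only for \<open>k = 2\<close>; it is then 11 = 7 + 4, which leaves one
    \<open>x_i\<close> after the root.\<close>
  also have "\<dots> = cartier (of_nat (6 choose 2) * ?x i ^ (4 * 2 + 3) * quartic_rest i ^ (6 - 2) * 1)"
    by (rule cartier_binomial) (auto intro!: intros dest!: small)
  also have "\<dots> = cartier ((?x a ^ 4 + (?x b ^ 4 + (?x c ^ 4 + ?x d ^ 4))) ^ 4
      * (?x a ^ 0 * (15 * ?x i ^ 11)))"
    by (simp add: rest choose_two mult_ac)
  also have "\<dots> = cartier (of_nat (4 choose 1) * ?x a ^ (4 * 1 + 0)
      * (?x b ^ 4 + (?x c ^ 4 + ?x d ^ 4)) ^ (4 - 1) * (15 * ?x i ^ 11))"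
    by (intro cartier_binomial intros mod) (use abcd(1) in auto)
  also have "\<dots> = cartier ((?x b ^ 4 + (?x c ^ 4 + ?x d ^ 4)) ^ 3
      * (?x b ^ 0 * (60 * ?x a ^ 4 * ?x i ^ 11)))"
    by (simp add: mult_ac)
  also have "\<dots> = cartier (of_nat (3 choose 1) * ?x b ^ (4 * 1 + 0)
      * (?x c ^ 4 + ?x d ^ 4) ^ (3 - 1) * (60 * ?x a ^ 4 * ?x i ^ 11))"
    by (intro cartier_binomial intros mod) (use abcd(1) in auto)
  also have "\<dots> = cartier ((?x c ^ 4 + ?x d ^ 4) ^ 2
      * (?x c ^ 0 * (180 * ?x b ^ 4 * ?x a ^ 4 * ?x i ^ 11)))"
    by (simp add: mult_ac)
  also have "\<dots> = cartier (of_nat (2 choose 1) * ?x c ^ (4 * 1 + 0)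
      * (?x d ^ 4) ^ (2 - 1) * (180 * ?x b ^ 4 * ?x a ^ 4 * ?x i ^ 11))"
    by (intro cartier_binomial intros mod) (use abcd(1) in auto)
  also have "\<dots> = cartier (360 * (?x a ^ 4 * ?x b ^ 4 * ?x c ^ 4 * ?x d ^ 4 * ?x i ^ 11))"
    by (simp add: mult_ac)
  also have "\<dots> = cartier (Poly_Mapping.single (Poly_Mapping.single a 4 + Poly_Mapping.single b 4
      + Poly_Mapping.single c 4 + Poly_Mapping.single d 4 + Poly_Mapping.single i 11) 360)"
    by (simp add: poly_var_def single_power single_funpow_add mult_single
        flip: single_numeral del: One_nat_def)
  also have "\<dots> = ?x i"
  proof -
    let ?M = "Poly_Mapping.single a 4 + Poly_Mapping.single b 4
      + Poly_Mapping.single c 4 + Poly_Mapping.single d 4 + Poly_Mapping.single i (11 :: nat)"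
    have M: "Poly_Mapping.lookup ?M j = (if j = i then 11 else 4)" for j
    proof -
      have "j = i \<or> j \<in> {a, b, c, d}"
        using abcd(2) by blast
      then show ?thesis
        using abcd(1) by (auto simp: lookup_add lookup_single when_def)
    qed
    then have "Poly_Mapping.map (\<lambda>n. n div 7) ?M = Poly_Mapping.single i 1"
      by (intro poly_mapping_eqI) (auto simp: lookup_map_div lookup_single when_def)
    then show ?thesis
      unfolding cartier_single M by (simp add: lam poly_var_def)
  qed
  finally show ?thesis
    using inverse_linear_cartier by (intro exI[of _ "\<lambda>h. cartier (quartic ^ (7 - 1) * h)"]) simp
qed

text \<open>Once \<open>7 ^ e\<close> exceeds all exponents of \<open>a\<close>, its monomials lie
  in distinct residue classes and one of them can be isolated. In \<open>poly_var i\<close> the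
  residue -1 picks the pure power out of \<open>quartic ^ (Q - 1)\<close>.\<close>

lemma ex_inverse_linear_free_to_cube:
  fixes a :: "'k::field poly5"
  assumes char: "CHAR('k) = 7" and free: "free_of i a" and a: "a \<noteq> 0"
  shows "\<exists>e\<ge>e0. \<exists>\<Psi>. inverse_linear (7 ^ e) \<Psi> \<and> \<Psi> (poly_var i ^ 3 * a) = poly_var i ^ 3"
proof -
  obtain m0 where m0: "m0 \<in> Poly_Mapping.keys a"
    using a by fastforce
  \<comment> \<open>A bound on the exponents suffices, since \<open>7 ^ e > e\<close>.\<close>
  define e where "e = Max (insert e0 ((\<lambda>(m, j). Poly_Mapping.lookup m j) ` (Poly_Mapping.keys a \<times> UNIV)))"
  have le: "Poly_Mapping.lookup m j \<le> e" if "m \<in> Poly_Mapping.keys a" for m j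
    unfolding e_def using that by (intro Max_ge) (auto simp: image_iff intro!: exI)
  have e: "e \<ge> e0"
    unfolding e_def by (intro Max_ge) auto
  have lt: "Poly_Mapping.lookup m j < 7 ^ e" if "m \<in> Poly_Mapping.keys a" for m j
    using le_less_trans[OF le[OF that] power_gt_expt[of 7 e]] by simp
  obtain lam where "frobenius_linear (7 ^ e) lam" and lam: "lam (Poly_Mapping.lookup a m0) = 1"
    using ex_frobenius_linear[OF char] m0 by (metis in_keys_iff)
  then interpret frobenius_linear "7 ^ e" lam
    by simp
  define r where "r j = (if j = i then 7 ^ e - 1 else Poly_Mapping.lookup m0 j)" for j
  interpret cartier "7 ^ e" lam r ..
  let ?x = "poly_var i :: 'k poly5" and ?Q = "7 ^ e :: nat"
  have "cartier (quartic ^ (?Q - 1) * (?x ^ 3 * a))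
      = cartier ((?x ^ 4 + quartic_rest i) ^ (?Q - 1) * (?x ^ 3 * a))"
    by (simp add: quartic_split[of i])
  also have "\<dots> = cartier (of_nat ((?Q - 1) choose (?Q - 1)) * ?x ^ (4 * (?Q - 1) + 3)
      * quartic_rest i ^ ((?Q - 1) - (?Q - 1)) * a)"
  proof (rule cartier_binomial)
    \<comment> \<open>Residue -1 means that \<open>Q\<close> divides \<open>4 (k + 1)\<close>, hence
      \<open>k + 1\<close>, which is impossible below the top index.\<close>
    fix k assume k: "k \<le> ?Q - 1" "k \<noteq> ?Q - 1"
    show "(4 * k + 3) mod ?Q \<noteq> r i"
    proof
      assume "(4 * k + 3) mod ?Q = r i"
      then have "(4 * k + 3 + 1) mod ?Q = (?Q - 1 + 1) mod ?Q"
        by (metis mod_add_left_eq r_def)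
      then have dvd: "?Q dvd 4 * (k + 1)"
        by (simp add: mod_eq_0_iff_dvd)
      have "coprime ?Q 4"
        by (intro coprime_power_left_iff[THEN iffD2] disjI1 prime_imp_coprime) simp_all
      then have "?Q dvd k + 1"
        using coprime_dvd_mult_right_iff dvd by blast
      then show False
        using k by (auto dest!: dvd_imp_le)
    qed
  qed (simp_all add: free free_of_quartic_rest)
  also have "\<dots> = cartier (\<Sum>m\<in>Poly_Mapping.keys a.
      ?x ^ (4 * ?Q - 1) * Poly_Mapping.single m (Poly_Mapping.lookup a m))"
    by (simp add: sum_single_keys diff_mult_distrib2 flip: sum_distrib_left)
  also have "\<dots> = (\<Sum>m\<in>Poly_Mapping.keys a. if m = m0 then ?x ^ 3 else 0)"
    unfolding cartier_sum
  proof (rule sum.cong)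
    fix m assume m: "m \<in> Poly_Mapping.keys a"
    have prod: "?x ^ (4 * ?Q - 1) * Poly_Mapping.single m (Poly_Mapping.lookup a m)
        = Poly_Mapping.single (Poly_Mapping.single i (4 * ?Q - 1) + m) (Poly_Mapping.lookup a m)"
      by (simp add: poly_var_def single_power single_funpow_add mult_single del: One_nat_def)
    have mi: "Poly_Mapping.lookup m i = 0" "Poly_Mapping.lookup m0 i = 0"
      using free m m0 by (auto simp: free_of_def)
    \<comment> \<open>\<open>4 Q - 1 = 3 Q + (Q - 1)\<close>: the residue is the selected one and
      the root is the cube.\<close>
    have div: "(4 * ?Q - 1) div ?Q = 3"
      using Q_pos by (intro div_nat_eqI) (simp_all add: mult.commute)
    moreover have "(4 * ?Q - 1) mod ?Q = ?Q - 1"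
      using Q_pos unfolding minus_mult_div_eq_mod[symmetric] div by linarith
    ultimately have i: "(4 * ?Q - 1) mod ?Q = ?Q - 1" "(4 * ?Q - 1) div ?Q = 3"
      by simp_all
    have "(\<forall>j. Poly_Mapping.lookup (Poly_Mapping.single i (4 * ?Q - 1) + m) j mod ?Q = r j)
        \<longleftrightarrow> m = m0"
      unfolding poly_mapping_eq_iff fun_eq_iff using lt[OF m] mi i
      by (auto simp: lookup_add lookup_single when_def r_def) metis
    moreover have "Poly_Mapping.map (\<lambda>n. n div ?Q) (Poly_Mapping.single i (4 * ?Q - 1) + m0)
        = Poly_Mapping.single i 3"
      using lt[OF m0] mi i
      by (intro poly_mapping_eqI) (auto simp: lookup_map_div lookup_add lookup_single when_def)
    ultimately show "cartier (?x ^ (4 * ?Q - 1) * Poly_Mapping.single m (Poly_Mapping.lookup a m))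
        = (if m = m0 then ?x ^ 3 else 0)"
      unfolding prod cartier_single
      by (simp add: lam poly_var_def single_power single_funpow_add del: One_nat_def)
  qed simp
  also have "\<dots> = ?x ^ 3"
    using m0 by simp
  finally show ?thesis
    using inverse_linear_cartier e by blast
qed

text \<open>Three moves are chained: a multiple of \<open>h\<close> is the free polynomial
  \<open>a\<close>, then \<open>x_i^3 a\<close> goes to \<open>x_i^3\<close>, then
  \<open>x_i^3\<close> to \<open>x_i\<close>. Composing the operators multiplies their exponents
  \<open>Q\<close>.\<close>

lemma ex_inverse_linear_to_var:
  fixes h :: "'k::field poly5"
  assumes char: "CHAR('k) = 7" and h: "\<not> quartic dvd h"
  shows "\<exists>e\<ge>e0. \<exists>\<Psi> d. inverse_linear (7 ^ e) \<Psi> \<and> quartic dvd \<Psi> (h * d) - poly_var i"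
proof -
  let ?x = "poly_var i :: 'k poly5"
  obtain d a where a: "free_of i a" "a \<noteq> 0" "quartic dvd h * d - a"
    using ex_free_multiple[OF char h] by blast
  obtain e \<Psi> where e: "e \<ge> e0" and \<Psi>: "inverse_linear (7 ^ e) \<Psi>" "\<Psi> (?x ^ 3 * a) = ?x ^ 3"
    using ex_inverse_linear_free_to_cube[OF char a(1,2)] by blast
  obtain \<Phi> where \<Phi>: "inverse_linear 7 \<Phi>" "\<Phi> (?x ^ 3) = ?x"
    using ex_inverse_linear_cube_to_var[OF char] by blast
  have diff: "\<Theta> (u - v) = \<Theta> u - \<Theta> v" if "inverse_linear Q \<Theta>" for Q \<Theta> and u v :: "'k poly5"
  proof -
    have "\<Theta> (u - v) + \<Theta> v = \<Theta> u"
      using that unfolding inverse_linear_def by (metis diff_add_cancel)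
    then show ?thesis
      by (simp add: algebra_simps)
  qed
  have "inverse_linear (7 ^ Suc e) (\<lambda>h. \<Phi> (\<Psi> h))"
    using \<Phi>(1) \<Psi>(1) unfolding inverse_linear_def by (simp add: power_mult)
  moreover have "quartic dvd \<Phi> (\<Psi> (h * (d * ?x ^ 3))) - ?x"
  proof -
    have "quartic dvd (h * d - a) * ?x ^ 3"
      using a(3) by simp
    then have "quartic dvd h * (d * ?x ^ 3) - ?x ^ 3 * a"
      by (simp add: algebra_simps)
    then have "quartic dvd \<Phi> (\<Psi> (h * (d * ?x ^ 3) - ?x ^ 3 * a))"
      using \<Phi>(1) \<Psi>(1) by (simp add: inverse_linear_def)
    then show ?thesis
      by (simp add: diff[OF \<Psi>(1)] diff[OF \<Phi>(1)] \<Psi>(2) \<Phi>(2))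
  qed
  ultimately show ?thesis
    using e by (meson le_SucI)
qed

section \<open>Ideals of polynomials and of the local ring\<close>

text \<open>The constant coefficient, written as an evaluation so that it is a ring homomorphism.
  Its nonzero values single out the denominators of the local ring.\<close>

definition at_origin :: "'k::field poly5 \<Rightarrow> 'k" where
  "at_origin = evaluation.ev (\<lambda>a. a) (\<lambda>_. 0)"

interpretation origin: evaluation "\<lambda>a :: 'k::field. a" "\<lambda>_ :: 5. 0"
  rewrites "evaluation.ev (\<lambda>a :: 'k. a) (\<lambda>_ :: 5. 0) = at_origin"
proof -
  show "evaluation (\<lambda>a :: 'k. a)"
    by standard simp_all
  show "evaluation.ev (\<lambda>a :: 'k. a) (\<lambda>_ :: 5. 0) = at_origin"
    by (simp only: at_origin_def)
qed

lemma at_origin_quartic: "at_origin quartic = 0"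
  unfolding quartic_def poly_var_def
  by (simp add: origin.ev_sum origin.ev_power origin.ev_single_single del: One_nat_def)

lemma at_origin_quartic_dvd: "quartic dvd h \<Longrightarrow> at_origin h = 0"
  by (auto simp: origin.ev_mult at_origin_quartic)

text \<open>Closure under negation is contained in multiplication by -1.\<close>

definition poly_ideal :: "'a::comm_ring_1 set \<Rightarrow> bool" where
  "poly_ideal J \<longleftrightarrow> 0 \<in> J \<and> (\<forall>a\<in>J. \<forall>b\<in>J. a + b \<in> J) \<and> (\<forall>r. \<forall>a\<in>J. r * a \<in> J)"

lemma poly_idealD:
  assumes "poly_ideal J"
  shows "0 \<in> J" "a \<in> J \<Longrightarrow> b \<in> J \<Longrightarrow> a + b \<in> J" "a \<in> J \<Longrightarrow> r * a \<in> J" "a \<in> J \<Longrightarrow> a * r \<in> J"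
  using assms unfolding poly_ideal_def by (blast, blast, blast, metis mult.commute)

lemma poly_ideal_diff: "poly_ideal J \<Longrightarrow> a \<in> J \<Longrightarrow> b \<in> J \<Longrightarrow> a - b \<in> J"
  using poly_idealD(2)[of J a "- 1 * b"] poly_idealD(3)[of J b "- 1"] by simp

lemma poly_ideal_at_origin: "poly_ideal {h. at_origin h = 0}"
  by (simp add: poly_ideal_def origin.ev_0 origin.ev_add origin.ev_mult)

lemma at_origin_eq_0_mem:
  fixes h :: "'k::field poly5"
  assumes J: "poly_ideal J" and vars: "\<And>i. poly_var i \<in> J" and h: "at_origin h = 0"
  shows "h \<in> J"
proof -
  \<comment> \<open>Subtracting the constant term makes the claim additive; every nonconstant term
    is divisible by a variable.\<close>
  have "h - Poly_Mapping.single 0 (at_origin h) \<in> J"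
  proof (induction h rule: poly_mapping_induct_single)
    case (single m a)
    show ?case
    proof (cases "m = 0")
      case True
      then show ?thesis
        by (simp add: origin.ev_const poly_idealD(1)[OF J])
    next
      case False
      then obtain i where i: "Poly_Mapping.lookup m i \<noteq> 0"
        by (auto simp: poly_mapping_eq_iff fun_eq_iff)
      have "m - Poly_Mapping.single i 1 + Poly_Mapping.single i 1 = m"
        using i by (intro poly_mapping_eqI)
          (auto simp: lookup_add lookup_minus lookup_single when_def)
      then have "Poly_Mapping.single m a = Poly_Mapping.single (m - Poly_Mapping.single i 1) a * poly_var i"
        by (simp add: poly_var_def mult_single)
      moreover have "at_origin (Poly_Mapping.single m a) = 0"
        using i by (auto simp: origin.ev_single power_0_left)
      ultimately show ?thesis
        using poly_idealD(3)[OF J vars] by simp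
    qed
  next
    case (add h h')
    then show ?case
      using poly_idealD(2)[OF J add] by (simp add: origin.ev_add single_add algebra_simps)
  qed
  with h show ?thesis
    by simp
qed

text \<open>Modulo \<open>y\<^sub>a\<^sup>2, y\<^sub>b\<^sup>2, y\<^sub>c\<^sup>2, y\<^sub>d\<^sup>2\<close> the cubes of \<open>y\<^sub>a + y\<^sub>b\<close> and \<open>y\<^sub>c + y\<^sub>d\<close>
  vanish, hence so does \<open>(y\<^sub>a + y\<^sub>b + y\<^sub>c + y\<^sub>d)\<^sup>5\<close>; here \<open>y\<^sub>j = x\<^sub>j\<^sup>4\<close>.\<close>
lemma var_power_20_mem:
  fixes J :: "'k::field poly5 set"
  assumes J: "poly_ideal J" and q: "quartic \<in> J" and vars: "\<And>j. j \<noteq> i \<Longrightarrow> poly_var j ^ 8 \<in> J"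
  shows "poly_var i ^ 20 \<in> J"
proof -
  obtain a b c d where abcd: "distinct [a, b, c, d, i]" "UNIV - {i} = {a, b, c, d}"
    by (rule obtain_other_indices)
  have cube: "(y + z) ^ 3 \<in> J" if "y\<^sup>2 \<in> J" "z\<^sup>2 \<in> J" for y z
  proof -
    have "(y + z) ^ 3 = (y + 3 * z) * y\<^sup>2 + (3 * y + z) * z\<^sup>2"
      by (simp add: algebra_simps power2_eq_square power3_eq_cube)
    then show ?thesis
      using that poly_idealD[OF J] by simp
  qed
  define s t where "s = poly_var a ^ 4 + (poly_var b ^ 4 :: 'k poly5)"
    and "t = poly_var c ^ 4 + (poly_var d ^ 4 :: 'k poly5)"
  have sq: "(poly_var j ^ 4)\<^sup>2 \<in> J" if "j \<in> {a, b, c, d}" for j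
    using vars[of j] that abcd(1) by (auto simp flip: power_mult)
  have st: "s ^ 3 \<in> J" "t ^ 3 \<in> J"
    unfolding s_def t_def by (intro cube sq; simp)+
  \<comment> \<open>In each binomial term, \<open>s\<close> or \<open>t\<close> has exponent at
    least 3.\<close>
  have "(s + t) ^ 5 = (s\<^sup>2 + 5 * s * t + 10 * t\<^sup>2) * s ^ 3 + (10 * s\<^sup>2 + 5 * s * t + t\<^sup>2) * t ^ 3"
    by (simp add: algebra_simps power2_eq_square power3_eq_cube numeral_eq_Suc)
  then have "(s + t) ^ 5 \<in> J"
    using st poly_idealD[OF J] by simp
  moreover have "poly_var i ^ 20 + (s + t) ^ 5 \<in> J"
  proof -
    have i4: "quartic = poly_var i ^ 4 + (s + t)"
      using abcd by (simp add: quartic_split[of i] quartic_rest_def s_def t_def add_ac)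
    \<comment> \<open>As 5 is odd, \<open>u + v\<close> divides the sum; here \<open>u + v\<close>
      is the quartic.\<close>
    have "u ^ 5 + v ^ 5 = (u + v) * (u ^ 4 - u ^ 3 * v + u\<^sup>2 * v\<^sup>2 - u * v ^ 3 + v ^ 4)"
      for u v :: "'k poly5"
      by (simp add: algebra_simps numeral_eq_Suc)
    from this[of "poly_var i ^ 4" "s + t"] show ?thesis
      using poly_idealD(4)[OF J q] by (simp add: i4 flip: power_mult)
  qed
  ultimately show ?thesis
    using poly_ideal_diff[OF J] by (metis add_diff_cancel_right')
qed

text \<open>The ideal generated by the \<open>q\<close>-th powers, built summand by summand so that
  an inverse-linear operator can be followed through the sum.\<close>

inductive_set power_span :: "'a::comm_ring_1 set \<Rightarrow> nat \<Rightarrow> 'a set" for I q where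
  zero: "0 \<in> power_span I q"
| add: "h \<in> power_span I q \<Longrightarrow> i \<in> I \<Longrightarrow> a * i ^ q + h \<in> power_span I q"

lemma power_span_add:
  "h \<in> power_span I q \<Longrightarrow> h' \<in> power_span I q \<Longrightarrow> h + h' \<in> power_span I q"
  by (induction rule: power_span.induct) (simp_all add: add.assoc power_span.add)

lemma power_span_mult: "h \<in> power_span I q \<Longrightarrow> r * h \<in> power_span I q"
  by (induction rule: power_span.induct)
    (simp_all add: distrib_left power_span.zero power_span.add flip: mult.assoc)

lemma poly_ideal_power_span: "poly_ideal (power_span I q)"
  by (simp add: poly_ideal_def power_span.zero power_span_add power_span_mult)

lemma power_mem_power_span: "i \<in> I \<Longrightarrow> i ^ q \<in> power_span I q"
  using power_span.add[OF power_span.zero, of i I 1 q] by simp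

text \<open>Since \<open>i ^ (q * Q)\<close> is the \<open>Q\<close>-th power of
  \<open>i ^ q\<close>, the operator sends \<open>a * i ^ (q * Q)\<close> to
  \<open>\<Psi> a * i ^ q\<close>.\<close>

lemma inverse_linear_power_span:
  assumes \<Psi>: "inverse_linear Q \<Psi>" and h: "h \<in> power_span I (q * Q)"
  shows "\<Psi> h \<in> power_span I q"
  using h
proof (induction rule: power_span.induct)
  case zero
  have "\<Psi> 0 = 0"
    using \<Psi> unfolding inverse_linear_def by (metis add.right_neutral add_left_imp_eq)
  then show ?case
    by (simp add: power_span.zero)
next
  case (add h i a)
  have "\<Psi> (a * i ^ (q * Q) + h) = \<Psi> a * i ^ q + \<Psi> h"
    using \<Psi> unfolding inverse_linear_def power_mult by (metis mult.commute)
  with add show ?case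
    by (simp add: power_span.add)
qed

section \<open>The local ring through its structure map from the polynomials\<close>

lemma (in cring) idealI_cring:
  assumes "I \<subseteq> carrier R" "\<zero> \<in> I" "\<And>a b. a \<in> I \<Longrightarrow> b \<in> I \<Longrightarrow> a \<oplus> b \<in> I"
    and mult: "\<And>r a. r \<in> carrier R \<Longrightarrow> a \<in> I \<Longrightarrow> r \<otimes> a \<in> I"
  shows "ideal I R"
proof (rule idealI)
  show "subgroup I (add_monoid R)"
  proof (rule add.subgroupI)
    fix a assume a: "a \<in> I"
    then have "\<ominus> a = (\<ominus> \<one>) \<otimes> a"
      using assms(1) by (simp add: subset_iff l_minus)
    with a mult show "\<ominus> a \<in> I"
      by simp
  qed (use assms in auto)
  show "a \<otimes> x \<in> I" if "a \<in> I" "x \<in> carrier R" for a x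
    using mult[OF that(2,1)] that assms(1) by (metis m_comm subsetD)
qed (use mult ring_axioms in auto)

text \<open>The localization is captured by its map from the polynomials: denominators become units,
  every element is a fraction, and the kernel is generated by the quartic. The argument on test
  ideals uses these properties instead of classes of pairs of cosets.\<close>

locale quartic_localization = cring L for L :: "('b, 'm) ring_scheme" (structure) +
  fixes \<pi> :: "'k::field poly5 \<Rightarrow> 'b"
  assumes char: "CHAR('k) = 7"
    and pi_closed [simp, intro]: "\<pi> h \<in> carrier L"
    and pi_add: "\<pi> (h + h') = \<pi> h \<oplus> \<pi> h'"
    and pi_mult: "\<pi> (h * h') = \<pi> h \<otimes> \<pi> h'"
    and pi_1: "\<pi> 1 = \<one>"
    and pi_unit: "at_origin s \<noteq> 0 \<Longrightarrow> \<exists>V\<in>carrier L. \<pi> s \<otimes> V = \<one>"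
    and pi_fraction: "U \<in> carrier L \<Longrightarrow> \<exists>a s. at_origin s \<noteq> 0 \<and> U \<otimes> \<pi> s = \<pi> a"
    and pi_eq_0_iff: "\<pi> h = \<zero> \<longleftrightarrow> quartic dvd h"
begin

lemma pi_0: "\<pi> 0 = \<zero>"
  by (simp add: pi_eq_0_iff)

lemma pi_power: "\<pi> (h ^ n) = \<pi> h [^] n"
  by (induction n) (simp_all add: pi_1 pi_mult m_comm)

lemma pi_diff: "\<pi> (h - h') = \<pi> h \<ominus> \<pi> h'"
proof -
  have "\<pi> (h - h') \<oplus> \<pi> h' = \<pi> h"
    by (simp flip: pi_add)
  then show ?thesis
    by (metis add.inv_solve_right' minus_eq pi_closed)
qed

lemma pi_eq_iff: "\<pi> h = \<pi> h' \<longleftrightarrow> quartic dvd h - h'"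
  by (simp flip: pi_eq_0_iff add: pi_diff)

lemma mem_ideal_cancel:
  assumes "ideal J L" "U \<in> carrier L" "at_origin s \<noteq> 0" "U \<otimes> \<pi> s \<in> J"
  shows "U \<in> J"
proof -
  obtain V where V: "V \<in> carrier L" "\<pi> s \<otimes> V = \<one>"
    using pi_unit[OF assms(3)] by blast
  then have "U = (U \<otimes> \<pi> s) \<otimes> V"
    using assms(2) by (simp add: m_assoc)
  then show ?thesis
    using ideal.I_r_closed[OF assms(1,4) V(1)] by simp
qed

text \<open>For an ideal \<open>J\<close>, the ideal of \<open>L\<close> generated by its image,
  phrased so that membership can be pulled back to polynomials.\<close>

definition extension :: "'k poly5 set \<Rightarrow> 'b set" where
  "extension J = {U \<in> carrier L. \<exists>w h. at_origin w \<noteq> 0 \<and> h \<in> J \<and> U \<otimes> \<pi> w = \<pi> h}"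

lemma pi_mem_extensionD:
  assumes "\<pi> h \<in> extension J"
  shows "\<exists>w h'. at_origin w \<noteq> 0 \<and> h' \<in> J \<and> quartic dvd w * h - h'"
  using assms by (auto simp: extension_def pi_eq_iff mult.commute simp flip: pi_mult)

lemma extension_memI: "U \<in> carrier L \<Longrightarrow> at_origin w \<noteq> 0 \<Longrightarrow> h \<in> J \<Longrightarrow> U \<otimes> \<pi> w = \<pi> h \<Longrightarrow> U \<in> extension J"
  by (auto simp: extension_def)

lemma pi_mem_extension: "h \<in> J \<Longrightarrow> \<pi> h \<in> extension J"
  by (rule extension_memI[of _ 1 h]) (simp_all add: origin.ev_1 pi_1)

lemma ideal_extension:
  assumes J: "poly_ideal J"
  shows "ideal (extension J) L"
proof (rule idealI_cring)
  show "\<zero> \<in> extension J"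
    using pi_mem_extension[OF poly_idealD(1)[OF J]] by (simp add: pi_0)
  show "U \<oplus> V \<in> extension J" if UV: "U \<in> extension J" "V \<in> extension J" for U V
  proof -
    obtain w h w' h' where *: "U \<in> carrier L" "at_origin w \<noteq> 0" "h \<in> J" "U \<otimes> \<pi> w = \<pi> h"
      "V \<in> carrier L" "at_origin w' \<noteq> 0" "h' \<in> J" "V \<otimes> \<pi> w' = \<pi> h'"
      using UV by (auto simp: extension_def)
    have "(U \<oplus> V) \<otimes> \<pi> (w * w') = (U \<otimes> \<pi> w) \<otimes> \<pi> w' \<oplus> (V \<otimes> \<pi> w') \<otimes> \<pi> w"
      using *(1,5) by (simp add: pi_mult l_distr r_distr m_ac)
    also have "\<dots> = \<pi> (h * w' + h' * w)"
      by (simp add: * pi_add pi_mult)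
    finally show ?thesis
      using * poly_idealD[OF J]
      by (intro extension_memI[of _ "w * w'" "h * w' + h' * w"]) (simp_all add: origin.ev_mult)
  qed
  show "r \<otimes> U \<in> extension J" if r: "r \<in> carrier L" and U: "U \<in> extension J" for r U
  proof -
    obtain w h where *: "U \<in> carrier L" "at_origin w \<noteq> 0" "h \<in> J" "U \<otimes> \<pi> w = \<pi> h"
      using U by (auto simp: extension_def)
    obtain a s where r': "at_origin s \<noteq> 0" "r \<otimes> \<pi> s = \<pi> a"
      using pi_fraction[OF r] by blast
    have "(r \<otimes> U) \<otimes> \<pi> (s * w) = (r \<otimes> \<pi> s) \<otimes> (U \<otimes> \<pi> w)"
      using *(1) r by (simp add: pi_mult m_ac)
    also have "\<dots> = \<pi> (a * h)"
      by (simp add: * r' pi_mult)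
    finally show ?thesis
      using * r r' poly_idealD[OF J]
      by (intro extension_memI[of _ "s * w" "a * h"]) (simp_all add: origin.ev_mult)
  qed
qed (auto simp: extension_def)

lemma poly_ideal_preimage:
  assumes "ideal I L"
  shows "poly_ideal {h. \<pi> h \<in> I}"
proof -
  interpret ideal I L by fact
  show ?thesis
    by (simp add: poly_ideal_def pi_0 pi_add pi_mult I_l_closed)
qed

abbreviation max_ideal :: "'b set" where
  "max_ideal \<equiv> Idl (range (\<lambda>i. \<pi> (poly_var i)))"

lemma ideal_max_ideal: "ideal max_ideal L"
  by (intro genideal_ideal) auto

text \<open>Polynomials without constant term are generated by the variables, and denominators are
  units. The fraction form decides membership by numerators.\<close>

lemma max_ideal_eq: "max_ideal = extension {h. at_origin h = 0}"
proof
  show "max_ideal \<subseteq> extension {h. at_origin h = 0}"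
    by (intro genideal_minimal ideal_extension poly_ideal_at_origin)
      (auto simp: poly_var_def origin.ev_single_single simp del: One_nat_def intro!: pi_mem_extension)
  have sub: "\<pi> h \<in> max_ideal" if "at_origin h = 0" for h
  proof -
    have "range (\<lambda>i. \<pi> (poly_var i)) \<subseteq> max_ideal"
      by (intro genideal_self) auto
    then show ?thesis
      using at_origin_eq_0_mem[OF poly_ideal_preimage[OF ideal_max_ideal] _ that] by auto
  qed
  show "extension {h. at_origin h = 0} \<subseteq> max_ideal"
  proof
    fix U assume "U \<in> extension {h. at_origin h = 0}"
    then obtain w h where "U \<in> carrier L" "at_origin w \<noteq> 0" "at_origin h = 0" "U \<otimes> \<pi> w = \<pi> h"
      by (auto simp: extension_def)
    then show "U \<in> max_ideal"
      using sub[of h] by (intro mem_ideal_cancel[OF ideal_max_ideal, of U w]) auto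
  qed
qed

lemma unit_outside_max_ideal:
  assumes U: "U \<in> carrier L" "U \<notin> max_ideal"
  shows "\<exists>V\<in>carrier L. V \<otimes> U = \<one>"
proof -
  obtain a s where a: "at_origin s \<noteq> 0" "U \<otimes> \<pi> s = \<pi> a"
    using pi_fraction[OF U(1)] by blast
  then have "at_origin a \<noteq> 0"
    using U by (auto simp: max_ideal_eq extension_def)
  then obtain V where V: "V \<in> carrier L" "\<pi> a \<otimes> V = \<one>"
    using pi_unit by blast
  have "(\<pi> s \<otimes> V) \<otimes> U = (U \<otimes> \<pi> s) \<otimes> V"
    using V(1) U(1) by (simp add: m_ac)
  then have "(\<pi> s \<otimes> V) \<otimes> U = \<one>"
    by (simp add: a V)
  then show ?thesis
    using V(1) by blast
qed

lemma one_notin_max_ideal: "\<one> \<notin> max_ideal"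
proof
  assume "\<one> \<in> max_ideal"
  then have "\<pi> 1 \<in> extension {h. at_origin h = 0}"
    by (simp add: pi_1 max_ideal_eq)
  from pi_mem_extensionD[OF this] obtain w h' :: "'k poly5"
    where w: "at_origin w \<noteq> 0" "at_origin h' = 0" "quartic dvd w - h'"
    by auto
  then show False
    using at_origin_quartic_dvd[OF w(3)] by (simp add: origin.ev_diff)
qed

text \<open>Elements outside \<open>max_ideal\<close> are units, so an ideal containing one contains
  1.\<close>

lemma ideal_subset_max_ideal:
  assumes I: "ideal I L" and "\<one> \<notin> I"
  shows "I \<subseteq> max_ideal"
proof (rule ccontr)
  assume "\<not> I \<subseteq> max_ideal"
  then obtain U where U: "U \<in> I" "U \<notin> max_ideal"
    by blast
  then have "U \<in> carrier L"
    using ideal.Icarr[OF I] by blast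
  then obtain V where "V \<in> carrier L" "V \<otimes> U = \<one>"
    using unit_outside_max_ideal U(2) by blast
  then show False
    using ideal.I_l_closed[OF I U(1)] assms(2) by metis
qed

lemma maximalideal_iff: "maximalideal M L \<longleftrightarrow> M = max_ideal"
proof
  have eq_carrier: "J = carrier L" if "ideal J L" "\<one> \<in> J" for J
    using that by (rule ideal.one_imp_carrier)
  assume M: "maximalideal M L"
  then have I: "ideal M L"
    by (rule maximalideal.axioms)
  moreover have "\<one> \<notin> M"
    using eq_carrier[OF I] maximalideal.I_notcarr[OF M] by auto
  ultimately have "M \<subseteq> max_ideal"
    by (rule ideal_subset_max_ideal)
  moreover have "max_ideal \<subseteq> carrier L"
    by (simp add: ideal.Icarr[OF ideal_max_ideal] subsetI)
  ultimately have "max_ideal = M \<or> max_ideal = carrier L"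
    using maximalideal.I_maximal[OF M ideal_max_ideal] by blast
  then show "M = max_ideal"
    using one_notin_max_ideal by auto
next
  assume M: "M = max_ideal"
  show "maximalideal M L"
    unfolding M
  proof (rule maximalidealI[OF ideal_max_ideal])
    show "carrier L \<noteq> max_ideal"
      using one_notin_max_ideal by auto
    show "J = max_ideal \<or> J = carrier L" if "ideal J L" "max_ideal \<subseteq> J" for J
      using that ideal_subset_max_ideal[OF that(1)] ideal.one_imp_carrier[OF that(1)] by blast
  qed
qed

end

section \<open>Tight closure in the local ring\<close>

context quartic_localization
begin

text \<open>The quartic vanishes at the origin, so it divides a constant only if that constant is
  0.\<close>

lemma ring_char_eq: "ring_char L = 7"
proof -
  have "[n] \<cdot> \<one> = \<pi> (of_nat n)" for n :: nat
    by (induction n) (simp_all add: pi_0 pi_add pi_1 a_comm)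
  moreover have "quartic dvd (of_nat n :: 'k poly5) \<longleftrightarrow> 7 dvd n" for n
  proof
    assume "quartic dvd (of_nat n :: 'k poly5)"
    from at_origin_quartic_dvd[OF this] have "(of_nat n :: 'k) = 0"
      by (simp add: origin.ev_const flip: single_of_nat)
    then show "7 dvd n"
      by (simp add: of_nat_eq_0_iff_char_dvd char)
  next
    assume "7 dvd n"
    then have "(of_nat n :: 'k poly5) = 0"
      by (simp add: of_nat_eq_0_iff_char_dvd CHAR_poly_mapping char)
    then show "quartic dvd (of_nat n :: 'k poly5)"
      by simp
  qed
  ultimately have "ring_char L = Gcd {n. 7 dvd n}"
    by (simp add: ring_char_def pi_eq_0_iff)
  also have "\<dots> = 7"
    by (intro dvd_antisym Gcd_dvd Gcd_greatest) auto
  finally show ?thesis .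
qed

text \<open>If \<open>s\<close> clears the denominator of \<open>U\<close> in \<open>I\<close>, then
  the numerator lies over \<open>I\<close>, and \<open>s ^ q\<close> clears the denominator of the
  \<open>q\<close>-th power.\<close>

lemma bracket_power_subset_extension:
  assumes I: "ideal I L"
  shows "bracket_power L I q \<subseteq> extension (power_span {h. \<pi> h \<in> I} q)"
  unfolding bracket_power_def
proof (intro genideal_minimal ideal_extension poly_ideal_power_span image_subsetI)
  fix U assume U: "U \<in> I"
  then have carr: "U \<in> carrier L"
    using ideal.Icarr[OF I] by blast
  then obtain a s where a: "at_origin s \<noteq> 0" "U \<otimes> \<pi> s = \<pi> a"
    using pi_fraction by blast
  have "\<pi> a \<in> I"
    using ideal.I_r_closed[OF I U, of "\<pi> s"] a(2) by simp
  then have "a ^ q \<in> power_span {h. \<pi> h \<in> I} q"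
    by (intro power_mem_power_span) simp
  moreover have "U [^] q \<otimes> \<pi> (s ^ q) = \<pi> (a ^ q)"
    by (simp add: pi_power nat_pow_distrib[symmetric] carr a)
  ultimately show "U [^] q \<in> extension (power_span {h. \<pi> h \<in> I} q)"
    using carr a by (intro extension_memI[of _ "s ^ q" "a ^ q"]) (simp_all add: origin.ev_power)
qed

lemma ideal_bracket_power:
  assumes I: "ideal I L"
  shows "ideal (bracket_power L I q) L"
  unfolding bracket_power_def using ideal.Icarr[OF I] by (intro genideal_ideal) auto

lemma power_mem_bracket_power:
  assumes I: "ideal I L" and U: "U \<in> I"
  shows "U [^] q \<in> bracket_power L I q"
  unfolding bracket_power_def using ideal.Icarr[OF I] U
  by (intro subsetD[OF genideal_self]) auto

lemma pi_power_span:
  assumes I: "ideal I L" and h: "h \<in> power_span {h. \<pi> h \<in> I} q"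
  shows "\<pi> h \<in> bracket_power L I q"
proof -
  note B = poly_idealD[OF poly_ideal_preimage[OF ideal_bracket_power[OF I, of q]]]
  from h show ?thesis
  proof (induction rule: power_span.induct)
    case zero
    show ?case
      using B(1) by simp
  next
    case (add h i a)
    have "i ^ q \<in> {h. \<pi> h \<in> bracket_power L I q}"
      using power_mem_bracket_power[OF I, of "\<pi> i" q] add by (simp add: pi_power)
    then show ?case
      using B(2)[OF B(3)] add.IH by simp
  qed
qed

text \<open>Primality of the quartic makes \<open>L\<close> a domain. Hence multipliers in the
  definition of tight closure are nonzero.\<close>

lemma zero_minimal_prime: "{\<zero>} \<in> minimal_primes L"
proof -
  have "primeideal {\<zero>} L"
  proof (rule primeidealI)
    show "carrier L \<noteq> {\<zero>}"
      using one_notin_max_ideal ideal_max_ideal additive_subgroup.zero_closed[of max_ideal L]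
      by (metis ideal.axioms(1) one_closed singletonD)
    fix U V assume UV: "U \<in> carrier L" "V \<in> carrier L" "U \<otimes> V \<in> {\<zero>}"
    obtain a s b t where *: "at_origin s \<noteq> 0" "U \<otimes> \<pi> s = \<pi> a" "at_origin t \<noteq> 0" "V \<otimes> \<pi> t = \<pi> b"
      using pi_fraction UV by meson
    have "\<pi> (a * b) = (U \<otimes> V) \<otimes> \<pi> (s * t)"
      unfolding pi_mult *(2,4)[symmetric] using UV(1,2) by (simp add: m_ac)
    then have "quartic dvd a * b"
      using UV(3) by (simp flip: pi_eq_0_iff)
    then have "\<pi> a = \<zero> \<or> \<pi> b = \<zero>"
      using quartic_dvd_mult[OF char] by (simp add: pi_eq_0_iff)
    then show "U \<in> {\<zero>} \<or> V \<in> {\<zero>}"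
      using mem_ideal_cancel[OF zeroideal UV(1) *(1)] mem_ideal_cancel[OF zeroideal UV(2) *(3)] *
      by auto
  qed (simp_all add: zeroideal is_cring)
  moreover have "Q = {\<zero>}" if "primeideal Q L" "Q \<subseteq> {\<zero>}" for Q
    using that additive_subgroup.zero_closed[of Q L] primeideal.axioms(1)[OF that(1)]
    by (metis ideal.axioms(1) insert_subset subset_singletonD empty_iff)
  ultimately show ?thesis
    by (simp add: minimal_primes_def)
qed

text \<open>An operator for a large \<open>Q\<close>, applied to numerators in the relation for
  \<open>q * Q\<close>, turns a multiple of the multiplier \<open>c\<close> into \<open>x_i\<close>
  and the power of \<open>u\<close> into its \<open>q\<close>-th power.\<close>

lemma var_mult_tight_closure:
  assumes I: "ideal I L" and u: "u \<in> tight_closure L I"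
  shows "\<pi> (poly_var i) \<otimes> u [^] ((7 :: nat) ^ n) \<in> bracket_power L I (7 ^ n)"
proof -
  obtain c e0 where c: "c \<in> carrier L - \<Union> (minimal_primes L)" and uc: "u \<in> carrier L"
    and cu: "\<And>e. e \<ge> e0 \<Longrightarrow> c \<otimes> u [^] ((7 :: nat) ^ e) \<in> bracket_power L I (7 ^ e)"
    using u by (auto simp: tight_closure_def ring_char_eq)
  have c0: "c \<in> carrier L" "c \<noteq> \<zero>"
    using c zero_minimal_prime by auto
  obtain h s where h: "at_origin s \<noteq> 0" "c \<otimes> \<pi> s = \<pi> h"
    using pi_fraction c0(1) by blast
  obtain a t where a: "at_origin t \<noteq> 0" "u \<otimes> \<pi> t = \<pi> a"
    using pi_fraction uc by blast
  have "\<pi> h \<noteq> \<zero>"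
    using mem_ideal_cancel[OF zeroideal c0(1) h(1)] c0(2) h(2) by auto
  then have "\<not> quartic dvd h"
    by (simp add: pi_eq_0_iff)
  then obtain e \<Psi> d where e: "e \<ge> e0" and \<Psi>: "inverse_linear (7 ^ e) \<Psi>"
    and \<Psi>_hd: "quartic dvd \<Psi> (h * d) - poly_var i"
    using ex_inverse_linear_to_var[OF char] by blast
  define q Q :: nat where "q = 7 ^ n" and "Q = 7 ^ e"
  have qQ: "q * Q = 7 ^ (n + e)" "q * Q > 0"
    by (simp_all add: q_def Q_def power_add)
  let ?I = "{h. \<pi> h \<in> I}"
  have "\<pi> (h * d * a ^ (q * Q)) = (c \<otimes> u [^] (q * Q)) \<otimes> \<pi> (s * d * t ^ (q * Q))"
    unfolding pi_mult pi_power h(2)[symmetric] a(2)[symmetric]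
    using c0(1) uc by (simp add: nat_pow_distrib m_ac)
  moreover have "c \<otimes> u [^] (q * Q) \<in> bracket_power L I (q * Q)"
    unfolding qQ using cu e by simp
  ultimately have "\<pi> (h * d * a ^ (q * Q)) \<in> bracket_power L I (q * Q)"
    using ideal.I_r_closed[OF ideal_bracket_power[OF I]] by simp
  then have "\<pi> (h * d * a ^ (q * Q)) \<in> extension (power_span ?I (q * Q))"
    using bracket_power_subset_extension[OF I] by blast
  then obtain w g where w: "at_origin w \<noteq> 0" "g \<in> power_span ?I (q * Q)"
    "quartic dvd w * (h * d * a ^ (q * Q)) - g"
    using pi_mem_extensionD by blast
  \<comment> \<open>The extra factor completes \<open>w\<close> to \<open>w ^ (q * Q)\<close>, a
    \<open>Q\<close>-th power that can leave the operator together with that of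
    \<open>a\<close>.\<close>
  define g' where "g' = w ^ (q * Q - 1) * g"
  have g': "g' \<in> power_span ?I (q * Q)"
    unfolding g'_def by (intro power_span_mult w)
  have "w ^ (q * Q) = w ^ (q * Q - 1) * w"
    using qQ(2) by (metis power_minus_mult)
  then have "((w * a) ^ q) ^ Q * (h * d) - g' = w ^ (q * Q - 1) * (w * (h * d * a ^ (q * Q)) - g)"
    by (simp add: g'_def power_mult_distrib algebra_simps flip: power_mult)
  then have "quartic dvd ((w * a) ^ q) ^ Q * (h * d) - g'"
    using w(3) by simp
  then have "quartic dvd \<Psi> (((w * a) ^ q) ^ Q * (h * d) - g')"
    using \<Psi> by (simp add: inverse_linear_def)
  moreover have "\<Psi> (((w * a) ^ q) ^ Q * (h * d) - g') = (w * a) ^ q * \<Psi> (h * d) - \<Psi> g'"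
  proof -
    have "\<Psi> (((w * a) ^ q) ^ Q * (h * d) - g') + \<Psi> g' = (w * a) ^ q * \<Psi> (h * d)"
      using \<Psi> unfolding inverse_linear_def Q_def by (metis diff_add_cancel)
    then show ?thesis
      by (simp add: eq_diff_eq)
  qed
  ultimately have dvd: "quartic dvd (w * a) ^ q * \<Psi> (h * d) - \<Psi> g'"
    by simp
  have "quartic dvd ((w * a) ^ q * \<Psi> (h * d) - \<Psi> g') - (w * a) ^ q * (\<Psi> (h * d) - poly_var i)"
    by (intro dvd_diff dvd dvd_mult \<Psi>_hd)
  then have "quartic dvd poly_var i * (w * a) ^ q - \<Psi> g'"
    by (simp add: algebra_simps)
  then have "\<pi> (poly_var i * (w * a) ^ q) = \<pi> (\<Psi> g')"
    by (simp add: pi_eq_iff)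
  moreover have "\<pi> (poly_var i * (w * a) ^ q) = (\<pi> (poly_var i) \<otimes> u [^] q) \<otimes> \<pi> ((t * w) ^ q)"
    unfolding pi_mult pi_power a(2)[symmetric] using uc by (simp add: nat_pow_distrib m_ac)
  moreover have "\<pi> (\<Psi> g') \<in> bracket_power L I q"
    using inverse_linear_power_span[of Q \<Psi> g' ?I q] \<Psi> g' by (intro pi_power_span I) (simp add: Q_def)
  ultimately have mem: "(\<pi> (poly_var i) \<otimes> u [^] q) \<otimes> \<pi> ((t * w) ^ q) \<in> bracket_power L I q"
    by simp
  have "at_origin ((t * w) ^ q) \<noteq> 0"
    using w(1) a(1) by (simp add: origin.ev_power origin.ev_mult)
  from mem_ideal_cancel[OF ideal_bracket_power[OF I] _ this mem]
  have "\<pi> (poly_var i) \<otimes> u [^] q \<in> bracket_power L I q"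
    using uc by simp
  then show ?thesis
    by (simp add: q_def)
qed

lemma ideal_test_ideal: "ideal (test_ideal L) L"
proof (rule idealI_cring)
  have tight: "u \<in> carrier L" if "u \<in> tight_closure L I" for u I
    using that by (simp add: tight_closure_def)
  note B = ideal_bracket_power
  show "\<zero> \<in> test_ideal L"
    using tight additive_subgroup.zero_closed[OF ideal.axioms(1)[OF B]]
    by (auto simp: test_ideal_def)
  show "c \<oplus> d \<in> test_ideal L" if "c \<in> test_ideal L" "d \<in> test_ideal L" for c d
    using that tight additive_subgroup.a_closed[OF ideal.axioms(1)[OF B]]
    by (auto simp: test_ideal_def l_distr)
  show "r \<otimes> c \<in> test_ideal L" if "r \<in> carrier L" "c \<in> test_ideal L" for r c
    using that tight ideal.I_l_closed[OF B] by (auto simp: test_ideal_def m_assoc)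
qed (auto simp: test_ideal_def)

lemma max_ideal_subset_test_ideal: "max_ideal \<subseteq> test_ideal L"
  by (intro genideal_minimal ideal_test_ideal)
    (auto simp: test_ideal_def ring_char_eq var_mult_tight_closure)

section \<open>The cube of a variable and the ideal of the other four\<close>

abbreviation other_vars_ideal :: "5 \<Rightarrow> 'b set" where
  "other_vars_ideal i \<equiv> Idl ((\<lambda>j. \<pi> (poly_var j)) ` (UNIV - {i}))"

lemma ideal_other_vars_ideal: "ideal (other_vars_ideal i) L"
  by (intro genideal_ideal) auto

lemma var_cube_mem_tight_closure: "\<pi> (poly_var i ^ 3) \<in> tight_closure L (other_vars_ideal i)"
proof -
  let ?I = "other_vars_ideal i"
  have var: "\<pi> (poly_var j) \<in> ?I" if "j \<noteq> i" for j
    using that by (intro subsetD[OF genideal_self]) auto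
  \<comment> \<open>The multiplier is 1. The case \<open>e = 0\<close> has to be left out, because
    the cube is not in the ideal itself.\<close>
  have "\<one> \<otimes> \<pi> (poly_var i ^ 3) [^] ((7 :: nat) ^ e) \<in> bracket_power L ?I (7 ^ e)" if "e \<ge> 1" for e
  proof -
    obtain n where n: "e = Suc n"
      using \<open>e \<ge> 1\<close> by (cases e) auto
    \<comment> \<open>The pullback of the bracket power along \<open>n\<close> Frobenius steps is an
      ideal. It contains \<open>x_j^7\<close> for the other variables, so the claim becomes that it
      contains \<open>x_i^21\<close>.\<close>
    define T where "T = {h. \<pi> (h ^ 7 ^ n) \<in> bracket_power L ?I (7 ^ e)}"
    note B = poly_idealD[OF poly_ideal_preimage[OF ideal_bracket_power[OF ideal_other_vars_ideal,
          of i "7 ^ e"]], unfolded mem_Collect_eq]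
    have frob: "(x + y) ^ 7 ^ n = x ^ 7 ^ n + y ^ 7 ^ n" for x y :: "'k poly5"
      by (rule freshmans_dream'[where n = n]) (simp_all add: CHAR_poly_mapping char)
    have T: "poly_ideal T"
      unfolding poly_ideal_def T_def using B by (simp add: frob power_mult_distrib power_0_left)
    have "quartic \<in> T"
    proof -
      have "\<pi> (quartic ^ 7 ^ n) = \<zero>"
        by (simp add: pi_eq_0_iff)
      then show ?thesis
        using B(1) by (simp add: T_def pi_0)
    qed
    moreover have "poly_var j ^ 8 \<in> T" if "j \<noteq> i" for j
    proof -
      have "\<pi> (poly_var j ^ 7 ^ e) \<in> bracket_power L ?I (7 ^ e)"
        using power_mem_bracket_power[OF ideal_other_vars_ideal var[OF that]] by (simp add: pi_power)
      then have "poly_var j ^ 7 \<in> T"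
        by (simp add: T_def n flip: power_mult)
      then have "poly_var j * poly_var j ^ 7 \<in> T"
        by (rule poly_idealD(3)[OF T])
      then show ?thesis
        by (simp add: numeral_eq_Suc)
    qed
    ultimately have "poly_var i ^ 20 \<in> T"
      by (rule var_power_20_mem[OF T])
    then have "poly_var i * poly_var i ^ 20 \<in> T"
      by (rule poly_idealD(3)[OF T])
    then have "\<pi> ((poly_var i ^ 21) ^ 7 ^ n) \<in> bracket_power L ?I (7 ^ e)"
      by (simp add: T_def numeral_eq_Suc)
    then show ?thesis
      by (simp add: n flip: power_mult pi_power)
  qed
  moreover have "\<one> \<notin> \<Union> (minimal_primes L)"
    using primeideal.I_notcarr ideal.one_imp_carrier primeideal.axioms(1)
    unfolding minimal_primes_def by fastforce
  ultimately show ?thesis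
    unfolding tight_closure_def ring_char_eq by blast
qed

text \<open>On the \<open>x_i\<close>-axis the other variables vanish and the quartic becomes
  \<open>t^4\<close>. Membership would make \<open>w t^3\<close> divisible by \<open>t^4\<close> for
  a denominator \<open>w\<close> with \<open>w(0)\<close> nonzero.\<close>

lemma var_cube_notin_ideal: "\<pi> (poly_var i ^ 3) \<notin> other_vars_ideal i"
proof
  assume mem: "\<pi> (poly_var i ^ 3) \<in> other_vars_ideal i"
  define v :: "5 \<Rightarrow> 'k poly" where "v j = (if j = i then [:0, 1:] else 0)" for j
  interpret X: evaluation "\<lambda>a :: 'k. [:a:]" v
    by standard (simp_all add: mult.commute)
  have X_var: "X.ev (poly_var j) = v j" for j
    unfolding poly_var_def by (rule X.ev_single_single)
  have X_quartic: "X.ev quartic = [:0, 1:] ^ 4"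
    unfolding quartic_split[of i] quartic_rest_def
    by (simp add: X.ev_add X.ev_sum X.ev_power X_var) (simp add: v_def)
  have X_0: "poly (X.ev h) 0 = at_origin h" for h
  proof (induction h rule: poly_mapping_induct_single)
    case (single m a)
    have "poly (v j) 0 = 0" for j
      by (simp add: v_def)
    then show ?case
      by (simp add: X.ev_single origin.ev_single poly_prod)
  qed (simp add: X.ev_add origin.ev_add)
  define J where "J = {h. [:0, 1:] ^ 4 dvd X.ev h}"
  have J: "poly_ideal J"
    by (simp add: J_def poly_ideal_def X.ev_0 X.ev_add X.ev_mult)
  have "other_vars_ideal i \<subseteq> extension J"
    by (intro genideal_minimal ideal_extension J image_subsetI pi_mem_extension)
      (simp add: J_def X_var v_def)
  with mem obtain w h where w: "at_origin w \<noteq> 0" "h \<in> J" "quartic dvd w * poly_var i ^ 3 - h"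
    using pi_mem_extensionD by blast
  have "X.ev quartic dvd X.ev (w * poly_var i ^ 3 - h)"
    using w(3) by (auto simp: X.ev_mult)
  then have "[:0, 1:] ^ 4 dvd X.ev w * [:0, 1:] ^ 3 - X.ev h"
    by (simp add: X_quartic X.ev_diff X.ev_mult X.ev_power X_var) (simp add: v_def)
  then have "[:0, 1:] ^ 4 dvd (X.ev w * [:0, 1:] ^ 3 - X.ev h) + X.ev h"
    using w(2) unfolding J_def by (intro dvd_add) auto
  then have "[:0, 1:] * [:0, 1:] ^ 3 dvd X.ev w * [:0, 1:] ^ 3"
    by (simp add: numeral_eq_Suc)
  then have "[:0, 1:] dvd X.ev w"
    by (subst (asm) dvd_mult_cancel_right) auto
  then have "at_origin w = 0"
    unfolding X_0[symmetric] by auto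
  with w(1) show False
    by simp
qed

lemma test_ideal_eq: "test_ideal L = max_ideal"
proof
  show "test_ideal L \<subseteq> max_ideal"
  proof (rule ideal_subset_max_ideal[OF ideal_test_ideal], rule notI)
    let ?I = "other_vars_ideal 0"
    assume "\<one> \<in> test_ideal L"
    \<comment> \<open>At exponent \<open>q = 1\<close> the multiplier 1 would put the cube into the
      ideal itself.\<close>
    then have "\<one> \<otimes> \<pi> (poly_var 0 ^ 3) [^] ((7 :: nat) ^ 0) \<in> bracket_power L ?I (7 ^ 0)"
      using var_cube_mem_tight_closure[of 0] ideal_other_vars_ideal[of 0]
      unfolding test_ideal_def ring_char_eq by blast
    moreover have "bracket_power L ?I 1 \<subseteq> ?I"
      unfolding bracket_power_def using ideal.Icarr[OF ideal_other_vars_ideal[of 0]]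
      by (intro genideal_minimal ideal_other_vars_ideal) auto
    ultimately show False
      using var_cube_notin_ideal[of 0] by auto
  qed
qed (rule max_ideal_subset_test_ideal)

end

section \<open>The local ring of the quartic at the origin\<close>

definition to_local_ring ::
  "'k::field poly5 \<Rightarrow> ('k poly5 set \<times> 'k poly5 set) set" where
  "to_local_ring h = fraction (quartic_ring TYPE('k))
     (carrier (quartic_ring TYPE('k)) - origin_ideal TYPE('k))
     (quartic_ideal TYPE('k) +>\<^bsub>poly5_ring TYPE('k)\<^esub> h) \<one>\<^bsub>quartic_ring TYPE('k)\<^esub>"

lemma cring_poly5_ring: "cring (poly5_ring TYPE('k::field))"
  unfolding poly5_ring_def by (rule cring_from_type_algebra)

lemma poly5_ring_simps [simp]:
  "carrier (poly5_ring TYPE('k::field)) = UNIV"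
  "x \<otimes>\<^bsub>poly5_ring TYPE('k)\<^esub> y = x * y" "x \<oplus>\<^bsub>poly5_ring TYPE('k)\<^esub> y = x + y"
  "\<one>\<^bsub>poly5_ring TYPE('k)\<^esub> = 1" "\<zero>\<^bsub>poly5_ring TYPE('k)\<^esub> = 0"
  by (simp_all add: poly5_ring_def ring_of_type_algebra_def)

lemma poly5_ring_minus: "x \<ominus>\<^bsub>poly5_ring TYPE('k::field)\<^esub> y = x - y"
proof -
  interpret cring "poly5_ring TYPE('k)"
    by (rule cring_poly5_ring)
  have "\<ominus>\<^bsub>poly5_ring TYPE('k)\<^esub> y = - y"
    by (rule minus_equality) simp_all
  then show ?thesis
    by (simp add: minus_eq)
qed

lemma quartic_ideal_eq: "quartic_ideal TYPE('k::field) = {h. quartic dvd h}"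
proof -
  interpret cring "poly5_ring TYPE('k)"
    by (rule cring_poly5_ring)
  have "quartic_ideal TYPE('k) = PIdl\<^bsub>poly5_ring TYPE('k)\<^esub> quartic"
    unfolding quartic_ideal_def quartic_def by (subst cgenideal_eq_genideal) simp_all
  then show ?thesis
    by (auto simp: cgenideal_def dvd_def mult.commute)
qed

text \<open>Everything is transported along the coset map \<open>c\<close>; its cosets of
  polynomials nonzero at the origin are exactly the denominators.\<close>

lemma quartic_localization_to_local_ring:
  assumes char: "CHAR('k::field) = 7"
  shows "quartic_localization (quartic_local_ring TYPE('k)) to_local_ring"
proof -
  let ?P = "poly5_ring TYPE('k)" and ?R = "quartic_ring TYPE('k)" and ?I = "quartic_ideal TYPE('k)"
  let ?S = "carrier ?R - origin_ideal TYPE('k)"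
  interpret P: cring ?P
    by (rule cring_poly5_ring)
  have idI: "ideal ?I ?P"
    unfolding quartic_ideal_def by (rule P.genideal_ideal) simp
  interpret I: ideal ?I ?P
    by (rule idI)
  interpret R: cring ?R
    unfolding quartic_ring_def by (rule I.quotient_is_cring[OF cring_poly5_ring])
  define c where "c = (\<lambda>h. ?I +>\<^bsub>?P\<^esub> h)"
  have hom: "c \<in> ring_hom ?P ?R"
    unfolding c_def quartic_ring_def by (rule I.rcos_ring_hom)
  have c_closed: "c h \<in> carrier ?R" and c_mult: "c (h * h') = c h \<otimes>\<^bsub>?R\<^esub> c h'"
    and c_add: "c (h + h') = c h \<oplus>\<^bsub>?R\<^esub> c h'" and c_1: "c 1 = \<one>\<^bsub>?R\<^esub>" for h h'
    using ring_hom_closed[OF hom] ring_hom_mult[OF hom] ring_hom_add[OF hom] ring_hom_one[OF hom]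
    by simp_all
  have c_0: "c 0 = \<zero>\<^bsub>?R\<^esub>"
    using c_add[of 0 0] c_closed[of 0] by (simp add: R.add.l_cancel_one')
  have c_surj: "\<exists>h. U = c h" if "U \<in> carrier ?R" for U
    using that by (auto simp: quartic_ring_def FactRing_def A_RCOSETS_def' c_def)
  have c_eq_iff: "c h = c h' \<longleftrightarrow> quartic dvd h - h'" for h h'
    unfolding c_def using P.quotient_eq_iff_same_a_r_cos[OF idI, of h h']
    by (simp add: poly5_ring_minus quartic_ideal_eq)
  have vars: "range (quartic_var TYPE('k)) \<subseteq> carrier ?R"
    using c_closed by (auto simp: quartic_var_def c_def)
  have idO: "ideal (origin_ideal TYPE('k)) ?R"
    unfolding origin_ideal_def by (rule R.genideal_ideal[OF vars])
  interpret O: ideal "origin_ideal TYPE('k)" ?R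
    by (rule idO)
  have origin_sub: "origin_ideal TYPE('k) \<subseteq> {c h |h. at_origin h = 0}"
    unfolding origin_ideal_def
  proof (rule R.genideal_minimal)
    show "ideal {c h |h. at_origin h = 0} ?R"
    proof (rule R.idealI_cring)
      show "\<zero>\<^bsub>?R\<^esub> \<in> {c h |h. at_origin h = 0}"
        using c_0 origin.ev_0 by (metis (mono_tags, lifting) mem_Collect_eq)
      show "U \<oplus>\<^bsub>?R\<^esub> V \<in> {c h |h. at_origin h = 0}"
        if UV: "U \<in> {c h |h. at_origin h = 0}" "V \<in> {c h |h. at_origin h = 0}" for U V
      proof -
        obtain h h' where "U = c h" "V = c h'" "at_origin h = 0" "at_origin h' = 0"
          using UV by blast
        then show ?thesis
          by (intro CollectI exI[of _ "h + h'"]) (simp add: c_add origin.ev_add)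
      qed
      show "r \<otimes>\<^bsub>?R\<^esub> U \<in> {c h |h. at_origin h = 0}"
        if r: "r \<in> carrier ?R" and U: "U \<in> {c h |h. at_origin h = 0}" for r U
      proof -
        obtain h g where "U = c h" "at_origin h = 0" "r = c g"
          using U c_surj[OF r] by blast
        then show ?thesis
          by (intro CollectI exI[of _ "g * h"]) (simp add: c_mult origin.ev_mult)
      qed
    qed (auto simp: c_closed)
    show "range (quartic_var TYPE('k)) \<subseteq> {c h |h. at_origin h = 0}"
      using origin.ev_single_single by (auto simp: quartic_var_def c_def poly_var_def)
  qed
  have origin_sup: "c h \<in> origin_ideal TYPE('k)" if h: "at_origin h = 0" for h
  proof -
    have "poly_ideal {h. c h \<in> origin_ideal TYPE('k)}"
      by (simp add: poly_ideal_def c_0 c_add c_mult O.I_l_closed c_closed)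
    moreover have "c (poly_var i) \<in> origin_ideal TYPE('k)" for i
      using R.genideal_self[OF vars] by (auto simp: origin_ideal_def quartic_var_def c_def)
    ultimately show ?thesis
      using at_origin_eq_0_mem[OF _ _ h] by blast
  qed
  have c_origin: "c h \<in> origin_ideal TYPE('k) \<longleftrightarrow> at_origin h = 0" for h
  proof
    assume "c h \<in> origin_ideal TYPE('k)"
    then obtain h' where "c h = c h'" "at_origin h' = 0"
      using origin_sub by blast
    then show "at_origin h = 0"
      using at_origin_quartic_dvd[of "h - h'"] by (simp add: c_eq_iff origin.ev_diff)
  qed (rule origin_sup)
  have c_S: "c h \<in> ?S \<longleftrightarrow> at_origin h \<noteq> 0" for h
    by (simp add: c_origin c_closed)
  interpret S: mult_subset ?R ?S
  proof unfold_locales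
    show "\<one>\<^bsub>?R\<^esub> \<in> ?S"
      unfolding c_1[symmetric] c_S by (simp add: origin.ev_1)
    show "s \<otimes>\<^bsub>?R\<^esub> t \<in> ?S" if st: "s \<in> ?S" "t \<in> ?S" for s t
    proof -
      obtain a b where "s = c a" "t = c b"
        using c_surj st by blast
      with st show ?thesis
        by (simp only: c_S origin.ev_mult flip: c_mult) simp
    qed
  qed simp
  have L: "quartic_local_ring TYPE('k) = localization ?R ?S"
    by (simp add: quartic_local_ring_def localization_at_def)
  have pi: "to_local_ring h = fraction ?R ?S (c h) (c 1)" for h
    by (simp add: to_local_ring_def c_def flip: c_1)
  have one_S: "c 1 \<in> ?S"
    unfolding c_S by (simp add: origin.ev_1)
  note S_intros = one_S c_closed
  interpret L: cring "localization ?R ?S"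
    by (rule S.cring_localization)
  show ?thesis
    unfolding L
  proof unfold_locales
    show "CHAR('k) = 7"
      by (rule char)
    fix h h' s :: "'k poly5" and U
    show "to_local_ring h \<in> carrier (localization ?R ?S)"
      unfolding pi by (intro S.fraction_closed S_intros)
    show "to_local_ring (h + h') = to_local_ring h \<oplus>\<^bsub>localization ?R ?S\<^esub> to_local_ring h'"
      unfolding pi by (subst S.add_fraction) (simp_all only: S_intros mult_1 flip: c_mult c_add)
    show "to_local_ring (h * h') = to_local_ring h \<otimes>\<^bsub>localization ?R ?S\<^esub> to_local_ring h'"
      unfolding pi by (subst S.mult_fraction) (simp_all only: S_intros mult_1 flip: c_mult c_add)
    show "to_local_ring 1 = \<one>\<^bsub>localization ?R ?S\<^esub>"
      unfolding pi S.localization_one c_1 ..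
    show "\<exists>V\<in>carrier (localization ?R ?S). to_local_ring s \<otimes>\<^bsub>localization ?R ?S\<^esub> V
        = \<one>\<^bsub>localization ?R ?S\<^esub>" if "at_origin s \<noteq> 0"
    proof
      have s: "c s \<in> ?S"
        using that unfolding c_S .
      show "fraction ?R ?S (c 1) (c s) \<in> carrier (localization ?R ?S)"
        by (intro S.fraction_closed S_intros s)
      show "to_local_ring s \<otimes>\<^bsub>localization ?R ?S\<^esub> fraction ?R ?S (c 1) (c s)
          = \<one>\<^bsub>localization ?R ?S\<^esub>"
        unfolding pi S.mult_fraction[OF c_closed one_S c_closed s] S.localization_one c_1[symmetric]
        using s by (intro S.fraction_eqI) (simp_all only: S_intros mult_1 mult_1_right flip: c_mult)
    qed
    show "\<exists>a s. at_origin s \<noteq> 0 \<and> U \<otimes>\<^bsub>localization ?R ?S\<^esub> to_local_ring s = to_local_ring a"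
      if U: "U \<in> carrier (localization ?R ?S)"
    proof -
      obtain x y where xy: "x \<in> carrier ?R" "y \<in> ?S" "U = fraction ?R ?S x y"
        using U by (rule S.fraction_cases)
      then obtain a s where as: "x = c a" "y = c s"
        using c_surj by blast
      have s: "c s \<in> ?S"
        using xy as by simp
      have "U \<otimes>\<^bsub>localization ?R ?S\<^esub> to_local_ring s = to_local_ring a"
        unfolding pi xy as S.mult_fraction[OF c_closed s c_closed one_S]
        using s by (intro S.fraction_eqI)
          (simp_all only: S_intros mult_1 mult_1_right mult.commute flip: c_mult)
      then show ?thesis
        using s c_S by blast
    qed
    show "to_local_ring h = \<zero>\<^bsub>localization ?R ?S\<^esub> \<longleftrightarrow> quartic dvd h"
    proof -
      have "to_local_ring h = \<zero>\<^bsub>localization ?R ?S\<^esub> \<longleftrightarrow>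
          (\<exists>w\<in>?S. w \<otimes>\<^bsub>?R\<^esub> (c 1 \<otimes>\<^bsub>?R\<^esub> c h) = w \<otimes>\<^bsub>?R\<^esub> (c 1 \<otimes>\<^bsub>?R\<^esub> c 0))"
        unfolding pi S.localization_zero c_0[symmetric] c_1[symmetric]
        by (intro S.fraction_eq_iff S_intros)
      also have "\<dots> \<longleftrightarrow> (\<exists>w. at_origin w \<noteq> 0 \<and> c (w * h) = c 0)"
      proof -
        have "(\<exists>w\<in>?S. \<phi> w) \<longleftrightarrow> (\<exists>w. at_origin w \<noteq> 0 \<and> \<phi> (c w))" for \<phi>
          using c_S c_surj by (metis DiffD1)
        then show ?thesis
          by (simp flip: c_mult)
      qed
      also have "\<dots> \<longleftrightarrow> (\<exists>w. at_origin w \<noteq> 0 \<and> quartic dvd w * h)"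
        by (simp add: c_eq_iff)
      \<comment> \<open>A denominator is nonzero at the origin, hence not divisible by the quartic,
        so primality removes it.\<close>
      also have "\<dots> \<longleftrightarrow> quartic dvd h"
      proof
        assume "\<exists>w. at_origin w \<noteq> 0 \<and> quartic dvd w * h"
        then show "quartic dvd h"
          using quartic_dvd_mult[OF char] at_origin_quartic_dvd by blast
      next
        assume "quartic dvd h"
        then show "\<exists>w. at_origin w \<noteq> 0 \<and> quartic dvd w * h"
          by (intro exI[of _ 1]) (simp add: origin.ev_1)
      qed
      finally show ?thesis .
    qed
  qed
qed

theorem mainTheorem3:
  assumes "CHAR('k::field) = 7"
  shows "test_ideal (quartic_local_ring TYPE('k)) =
           Idl\<^bsub>quartic_local_ring TYPE('k)\<^esub> (range (local_var TYPE('k)))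
         \<and> (\<forall>M. maximalideal M (quartic_local_ring TYPE('k)) \<longleftrightarrow>
               M = Idl\<^bsub>quartic_local_ring TYPE('k)\<^esub> (range (local_var TYPE('k))))"
proof -
  interpret quartic_localization "quartic_local_ring TYPE('k)" to_local_ring
    by (rule quartic_localization_to_local_ring[OF assms])
  have "local_var TYPE('k) = (\<lambda>i. to_local_ring (poly_var i))"
    by (simp add: fun_eq_iff local_var_def to_local_ring_def quartic_var_def)
  then show ?thesis
    by (simp add: test_ideal_eq maximalideal_iff)
qed

end
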